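(* Let $n\ge 3$, let $\Gamma\subset\mathbb{R}^n$ be a lattice and let $V=V(\Gamma)$ be its set of visible points. Then the natural autocorrelation $\gamma$ of $V$ exists and is supported on $\Gamma$, i.e. $\gamma=\sum_{\mathbf{a}\in\Gamma}w(\mathbf{a})\delta_{\mathbf{a}}$, and for each $\mathbf{a}\in\Gamma$ the weight of $\mathbf{a}$ is $$w(\mathbf{a})=\mathrm{dens}(\Gamma)\,\xi(n)\prod_{p\mid\mathrm{cont}(\mathbf{a})}\Bigl(1+\frac{1}{p^n-2}\Bigr),$$ with error term $O(1/R)$, that is, $$\Bigl|\,w(\mathbf{a})-\frac{1}{v_nR^n}\,\bigl|\{\mathbf{x}\in V\mid \mathbf{x}-\mathbf{a}\in V,\ |\mathbf{x}|<R,\ |\mathbf{x}-\mathbf{a}|<R\}\bigr|\,\Bigr|=O(1/R)\quad (R\to\infty),$$ where the implied constant depends on $\mathbf{a}$ as well as on $\Gamma$.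
   Context: A lattice in $\mathbb{R}^n$ is $\Gamma=\mathbb{Z}\mathbf{b}_1\oplus\cdots\oplus\mathbb{Z}\mathbf{b}_n$ with $\mathbf{b}_1,\dots,\mathbf{b}_n$ linearly independent; $\mathrm{dens}(\Gamma)=1/|\det(\mathbf{b}_1,\dots,\mathbf{b}_n)|$. For $\mathbf{x}\in\Gamma\setminus\{\mathbf{0}\}$, $\mathrm{cont}(\mathbf{x})=\max\{l\in\mathbb{Z}^+\mid\mathbf{x}\in l\Gamma\}$, and $\mathrm{cont}(\mathbf{0})=\infty$, with the convention that every prime divides $\infty$ (so for $\mathbf{a}=\mathbf{0}$ the product is over all primes). The set of visible points is $V(\Gamma)=\{\mathbf{x}\in\Gamma\mid\mathrm{cont}(\mathbf{x})=1\}$. The products run over primes $p$; $\xi(s)=\prod_p\bigl(1-\frac{2}{p^s}\bigr)$ for $\mathrm{Re}(s)>1$. The natural autocorrelation of a uniformly discrete set $S\subset\mathbb{R}^n$ is $$\gamma=\lim_{R\to\infty}\frac{1}{v_nR^n}\sum_{\mathbf{x},\mathbf{y}\in S,\ |\mathbf{x}|,|\mathbf{y}|<R}\delta_{\mathbf{x}-\mathbf{y}},$$ the limit taken in the weak*-topology on the space of tempered distributions (if it exists), where $v_n$ is the volume of the unit ball of $\mathbb{R}^n$ and $\delta_{\mathbf{x}}$ is the Dirac distribution at $\mathbf{x}$. *)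

theory Defs
  imports "HOL-Analysis.Analysis" "HOL-Library.Landau_Symbols" "HOL-Library.Extended_Nat"
    "HOL-Computational_Algebra.Primes"
begin

section \<open>Lattices and visible points\<close>

definition lattice_basis :: "('n::finite \<Rightarrow> real^'n) \<Rightarrow> (real^'n) set \<Rightarrow> bool" where
  "lattice_basis b \<Gamma> \<longleftrightarrow> inj b \<and> independent (range b) \<and>
     \<Gamma> = range (\<lambda>c :: 'n \<Rightarrow> int. \<Sum>i\<in>UNIV. of_int (c i) *\<^sub>R b i)"

definition is_lattice :: "(real^'n::finite) set \<Rightarrow> bool" where
  "is_lattice \<Gamma> \<longleftrightarrow> (\<exists>b. lattice_basis b \<Gamma>)"

text \<open>The value does not depend on the basis; see \<open>dens_eq\<close> below.\<close>

definition dens :: "(real^'n::finite) set \<Rightarrow> real" where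
  "dens \<Gamma> = (THE d. \<exists>b. lattice_basis b \<Gamma> \<and> d = 1 / \<bar>det (\<chi> i. b i)\<bar>)"

definition cont :: "(real^'n::finite) set \<Rightarrow> real^'n \<Rightarrow> enat" where
  "cont \<Gamma> x = (if x = 0 then \<infinity>
     else enat (Max {l::nat. l \<ge> 1 \<and> x \<in> (\<lambda>y. real l *\<^sub>R y) ` \<Gamma>}))"

definition visible :: "(real^'n::finite) set \<Rightarrow> (real^'n) set" where
  "visible \<Gamma> = {x \<in> \<Gamma>. cont \<Gamma> x = 1}"

text \<open>Divisibility of a content by a prime \<open>p\<close> is \<open>enat p dvd cont \<Gamma> x\<close>. In the semiring
  \<^typ>\<open>enat\<close> this already incorporates the convention that every prime divides \<open>\<infinity>\<close>:\<close>

lemma prime_dvd_infinity: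
  assumes "prime (p::nat)"
  shows "enat p dvd \<infinity>"
proof (rule dvdI)
  have "0 < enat p" using prime_gt_0_nat[OF assms] by (simp add: zero_enat_def)
  then show "\<infinity> = enat p * \<infinity>" by (simp only: imult_infinity_right)
qed

lemma enat_dvd_enat_iff: "enat p dvd enat m \<longleftrightarrow> p dvd m"
proof
  assume "enat p dvd enat m"
  then obtain k where k: "enat m = enat p * k" by (rule dvdE)
  show "p dvd m"
  proof (cases k)
    case (enat j)
    then show ?thesis using k by simp
  next
    case infinity
    then show ?thesis using k
      by (cases "p = 0") (auto simp: zero_enat_def times_enat_simps)
  qed
next
  assume "p dvd m"
  then obtain j where "m = p * j" by (rule dvdE)
  then show "enat p dvd enat m" by (intro dvdI[of _ _ "enat j"]) simp
qed

text \<open>Products over primes are written as infinite products over all natural numbers, with factor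
  1 at the non-primes. The type class makes this usable both for real and for complex \<open>s\<close>.\<close>

definition xi :: "'a \<Rightarrow> 'a::{real_normed_field, ln}" where
  "xi s = (\<Prod>p. if prime p then 1 - 2 / (of_nat p powr s) else 1)"


section \<open>Tempered distributions\<close>

text \<open>Iterated partial derivatives, with a multi-index given as a list of coordinate directions.\<close>

primrec pderivs :: "'n::finite list \<Rightarrow> (real^'n \<Rightarrow> complex) \<Rightarrow> real^'n \<Rightarrow> complex" where
  "pderivs [] \<phi> = \<phi>"
| "pderivs (i # \<alpha>) \<phi> = (\<lambda>x. frechet_derivative (pderivs \<alpha> \<phi>) (at x) (axis i 1))"

definition smooth :: "(real^'n::finite \<Rightarrow> complex) \<Rightarrow> bool" where
  "smooth \<phi> \<longleftrightarrow> (\<forall>\<alpha> x. pderivs \<alpha> \<phi> differentiable (at x))"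

definition schwartz :: "(real^'n::finite \<Rightarrow> complex) set" where
  "schwartz = {\<phi>. smooth \<phi> \<and>
     (\<forall>k \<alpha>. bdd_above (range (\<lambda>x. (1 + norm x) ^ k * norm (pderivs \<alpha> \<phi> x))))}"

definition schwartz_seminorm :: "nat \<Rightarrow> 'n::finite list \<Rightarrow> (real^'n \<Rightarrow> complex) \<Rightarrow> real" where
  "schwartz_seminorm k \<alpha> \<phi> = (SUP x. (1 + norm x) ^ k * norm (pderivs \<alpha> \<phi> x))"

definition schwartz_topology :: "(real^'n::finite \<Rightarrow> complex) topology" where
  "schwartz_topology = topology_generated_by
     {{\<psi> \<in> schwartz. schwartz_seminorm k \<alpha> (\<lambda>x. \<psi> x - \<phi> x) < r} | k \<alpha> \<phi> r. \<phi> \<in> schwartz \<and> 0 < r}"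

text \<open>Distributions are functionals on \<^const>\<open>schwartz\<close>, made extensional so that equality of
  distributions is equality of functions and the product topology can be used below.\<close>

definition tempered_distributions :: "((real^'n::finite \<Rightarrow> complex) \<Rightarrow> complex) set" where
  "tempered_distributions = {T \<in> extensional schwartz.
     (\<forall>\<phi>\<in>schwartz. \<forall>\<psi>\<in>schwartz. T (\<lambda>x. \<phi> x + \<psi> x) = T \<phi> + T \<psi>) \<and>
     (\<forall>c. \<forall>\<phi>\<in>schwartz. T (\<lambda>x. c * \<phi> x) = c * T \<phi>) \<and>
     continuous_map schwartz_topology euclidean T}"

text \<open>The weak*-topology is the topology of pointwise convergence on \<^const>\<open>schwartz\<close>.\<close>

definition weak_star :: "((real^'n::finite \<Rightarrow> complex) \<Rightarrow> complex) topology" where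
  "weak_star = subtopology (product_topology (\<lambda>_. euclidean) schwartz) tempered_distributions"

definition dirac :: "real^'n::finite \<Rightarrow> (real^'n \<Rightarrow> complex) \<Rightarrow> complex" where
  "dirac a = (\<lambda>\<phi>\<in>schwartz. \<phi> a)"

text \<open>\<open>T = (\<Sum>a\<in>A. w a \<delta>\<^sub>a)\<close>, the possibly infinite sum being taken unconditionally
  in the weak*-topology.\<close>

definition is_dirac_comb ::
  "((real^'n::finite \<Rightarrow> complex) \<Rightarrow> complex) \<Rightarrow> (real^'n) set \<Rightarrow> (real^'n \<Rightarrow> real) \<Rightarrow> bool" where
  "is_dirac_comb T A w \<longleftrightarrow> T \<in> tempered_distributions \<and>
     (\<forall>\<phi>\<in>schwartz. ((\<lambda>a. of_real (w a) * dirac a \<phi>) has_sum T \<phi>) A)"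


section \<open>Natural autocorrelation\<close>

definition ball_normalizer :: "'n::finite itself \<Rightarrow> real \<Rightarrow> real" where
  "ball_normalizer _ R = 1 / (measure lborel (ball (0::real^'n) 1) * R ^ CARD('n))"

definition finite_autocorrelation ::
  "(real^'n::finite) set \<Rightarrow> real \<Rightarrow> (real^'n \<Rightarrow> complex) \<Rightarrow> complex" where
  "finite_autocorrelation S R = (\<lambda>\<phi>\<in>schwartz. of_real (ball_normalizer TYPE('n) R) *
     (\<Sum>(x, y) \<in> {x\<in>S. norm x < R} \<times> {y\<in>S. norm y < R}. dirac (x - y) \<phi>))"

definition has_natural_autocorrelation ::
  "(real^'n::finite) set \<Rightarrow> ((real^'n \<Rightarrow> complex) \<Rightarrow> complex) \<Rightarrow> bool" where
  "has_natural_autocorrelation S \<gamma> \<longleftrightarrow> uniform_discrete S \<and>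
     limitin weak_star (finite_autocorrelation S) \<gamma> at_top"


section \<open>Well-definedness\<close>

lemma natural_autocorrelation_unique:
  assumes "has_natural_autocorrelation S \<gamma>" "has_natural_autocorrelation S \<gamma>'"
  shows "\<gamma> = \<gamma>'"
proof -
  have "Hausdorff_space (weak_star :: ((real^'n \<Rightarrow> complex) \<Rightarrow> complex) topology)"
    unfolding weak_star_def
    by (rule Hausdorff_space_subtopology) (simp add: Hausdorff_space_product_topology)
  then show ?thesis
    using assms limitin_Hausdorff_unique[of weak_star "finite_autocorrelation S" \<gamma> at_top \<gamma>']
    by (auto simp: has_natural_autocorrelation_def)
qed

lemma lattice_basis_mem:
  fixes b :: "'n::finite \<Rightarrow> real^'n"
  assumes "lattice_basis b \<Gamma>"
  shows "b i \<in> \<Gamma>"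
proof -
  have "b i = (\<Sum>j\<in>UNIV. of_int ((\<lambda>j. if j = i then 1 else 0) j) *\<^sub>R b j)"
    by (simp add: if_distrib[of of_int] if_distrib[of "\<lambda>c. c *\<^sub>R _"] cong: if_cong)
  then have "b i \<in> range (\<lambda>c :: 'n \<Rightarrow> int. \<Sum>i\<in>UNIV. of_int (c i) *\<^sub>R b i)"
    by (rule range_eqI[where x = "\<lambda>j. if j = i then 1 else 0"])
  then show ?thesis using assms unfolding lattice_basis_def by simp
qed

lemma lattice_basis_change:
  fixes b c :: "'n::finite \<Rightarrow> real^'n"
  assumes "lattice_basis b \<Gamma>" "lattice_basis c \<Gamma>"
  obtains k :: int where "det (\<chi> i. b i) = of_int k * det (\<chi> i. c i)"
proof -
  have "\<exists>P :: 'n \<Rightarrow> int. b i = (\<Sum>j\<in>UNIV. of_int (P j) *\<^sub>R c j)" for i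
    using lattice_basis_mem[OF assms(1), of i] assms(2) by (auto simp: lattice_basis_def)
  then obtain P :: "'n \<Rightarrow> 'n \<Rightarrow> int"
    where P: "\<And>i. b i = (\<Sum>j\<in>UNIV. of_int (P i j) *\<^sub>R c j)" by metis
  have "(\<chi> i. b i) = (\<chi> i j. of_int (P i j)) ** (\<chi> i. c i)"
    by (simp add: vec_eq_iff matrix_matrix_mult_def P)
  then have "det (\<chi> i. b i) = det (\<chi> i j. real_of_int (P i j)) * det (\<chi> i. c i)"
    by (simp add: det_mul)
  moreover have "det (\<chi> i j. real_of_int (P i j)) =
      of_int (\<Sum>p | p permutes UNIV. sign p * (\<Prod>i\<in>UNIV. P i (p i)))"
    by (simp add: det_def)
  ultimately show ?thesis using that by metis
qed

lemma dens_eq: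
  fixes b :: "'n::finite \<Rightarrow> real^'n"
  assumes "lattice_basis b \<Gamma>"
  shows "dens \<Gamma> = 1 / \<bar>det (\<chi> i. b i)\<bar>"
proof -
  have *: "\<bar>det (\<chi> i. c i)\<bar> = \<bar>det (\<chi> i. b i)\<bar>" if c: "lattice_basis c \<Gamma>" for c
  proof -
    obtain k where k: "det (\<chi> i. b i) = of_int k * det (\<chi> i. c i)"
      using lattice_basis_change[OF assms c] .
    obtain l where l: "det (\<chi> i. c i) = of_int l * det (\<chi> i. b i)"
      using lattice_basis_change[OF c assms] .
    show ?thesis
    proof (cases "det (\<chi> i. b i) = 0")
      case True
      then show ?thesis using l by simp
    next
      case False
      have "det (\<chi> i. b i) = of_int (k * l) * det (\<chi> i. b i)" using k l by simp
      then have "real_of_int (k * l) = 1" using False by simp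
      then have "k * l = 1" using of_int_eq_1_iff by blast
      then have "\<bar>k\<bar> = 1" by (auto simp: zmult_eq_1_iff)
      then show ?thesis using k by (simp add: abs_mult flip: of_int_abs)
    qed
  qed
  show ?thesis unfolding dens_def
  proof (rule the_equality)
    show "\<exists>c. lattice_basis c \<Gamma> \<and> 1 / \<bar>det (\<chi> i. b i)\<bar> = 1 / \<bar>det (\<chi> i. c i)\<bar>"
      using assms by blast
  next
    fix d assume "\<exists>c. lattice_basis c \<Gamma> \<and> d = 1 / \<bar>det (\<chi> i. c i)\<bar>"
    then obtain c where "lattice_basis c \<Gamma>" "d = 1 / \<bar>det (\<chi> i. c i)\<bar>" by blast
    then show "d = 1 / \<bar>det (\<chi> i. b i)\<bar>" by (simp only: *)
  qed
qed

end

theory Submission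
  imports Defs
begin

text \<open>
  A lattice point is visible if no prime divides its content. For a fixed difference \<open>a\<close>, whether
  \<open>x\<close> and \<open>x - a\<close> are both visible is therefore decided prime by prime: \<open>x\<close> has to avoid the class of
  \<open>0\<close> and the class of \<open>a\<close> modulo \<open>p\<Gamma>\<close>. These are one class out of \<open>p ^ n\<close> if \<open>p\<close> divides the
  content of \<open>a\<close>, and two classes otherwise. If the primes were independent, the proportion of such
  \<open>x\<close> would be the product of the factors \<open>1 - 1 / p ^ n\<close> and \<open>1 - 2 / p ^ n\<close>, and this is the
  claimed weight divided by the density of \<open>\<Gamma>\<close> (\<open>pair_density_eq_prodinf\<close>).

  Independence with an error term is proved by inclusion-exclusion (\<open>visible_pair_indicator\<close>) over
  pairs \<open>(A, B)\<close> of disjoint finite sets of primes, where \<open>B\<close> avoids the primes that divide the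
  content of \<open>a\<close>. The condition that \<open>\<Prod>A\<close> divides the content of \<open>x\<close>
  and \<open>\<Prod>B\<close> that of \<open>x - a\<close> describes one coset of \<open>d\<Gamma>\<close> with \<open>d = \<Prod>A * \<Prod>B\<close>
  (\<open>simultaneous_divisibility_coset\<close>). In the intersection of the two balls of radius \<open>R\<close>, the number of points of a coset
  is its share of the volume up to \<open>O((R / d) ^ (n - 1) + 1)\<close> (\<open>count_coset\<close>),
  by comparison with a tiling by fundamental cells. Only pairs with \<open>\<Prod>A\<close> and \<open>\<Prod>B\<close> of order at most \<open>R\<close> occur, because the
  content of a nonzero point is bounded by a multiple of its norm. The errors add up to
  \<open>O(R ^ (n - 1)) + O(R\<^sup>2)\<close>, which is \<open>O(R ^ (n - 1))\<close> for \<open>n \<ge> 3\<close> (\<open>visible_pairs_asymptotics\<close>).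

  For the autocorrelation itself, the finite approximations are combs of point masses on \<open>\<Gamma>\<close>
  whose coefficients are these normalised counts. The coefficients are bounded uniformly in \<open>a\<close> and \<open>R\<close>, and
  test functions decay fast enough to be summable over \<open>\<Gamma>\<close>, so the limit may be taken coefficient by
  coefficient (\<open>dirac_comb_tendsto\<close>), and all the combs involved are tempered
  (\<open>dirac_comb_tempered\<close>).
\<close>

section \<open>Volumes of linear images\<close>

text \<open>The index type of a lattice carries no order, so there is no notion of a triangular matrix. After
  decomposition into elementary maps, the determinant of a transvection is instead found as that of
  the identity after a row operation.\<close>

lemma lmeasure_linear_image:
  fixes f :: "real^'n::finite \<Rightarrow> real^'n"
  assumes "linear f" "S \<in> lmeasurable"
  shows "f ` S \<in> lmeasurable \<and> measure lebesgue (f ` S) = \<bar>det (matrix f)\<bar> * measure lebesgue S"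
proof -
  define P where "P f \<longleftrightarrow> (\<forall>S\<in>lmeasurable. f ` S \<in> lmeasurable \<and>
     measure lebesgue (f ` S) = \<bar>det (matrix f)\<bar> * measure lebesgue S)" for f :: "real^'n \<Rightarrow> real^'n"
  have boxes: "P h" if "linear h" "\<bar>det (matrix h)\<bar> = 1"
    "\<And>a b. cbox a b \<noteq> {} \<Longrightarrow> measure lebesgue (h ` cbox a b) = measure lebesgue (cbox a b)"
    for h :: "real^'n \<Rightarrow> real^'n"
    unfolding P_def
  proof
    fix S :: "(real^'n) set" assume S: "S \<in> lmeasurable"
    have "measure lebesgue (h ` cbox a b) = 1 * measure lebesgue (cbox a b)" for a b
      using that(3)[of a b] by (cases "cbox a b = {}") auto
    from measure_linear_sufficient[OF that(1) S this]
    show "h ` S \<in> lmeasurable \<and> measure lebesgue (h ` S) = \<bar>det (matrix h)\<bar> * measure lebesgue S"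
      using that(2) by simp
  qed
  have "P f"
  proof (rule induct_linear_elementary[OF assms(1)])
    show "P (f \<circ> g)" if "linear f" "linear g" "P f" "P g" for f g
    proof -
      have "(f \<circ> g) ` S = f ` g ` S" for S by auto
      then show ?thesis
        using that(3,4) matrix_compose[OF that(2,1)] unfolding P_def by (simp only: det_mul abs_mult mult.assoc) auto
    qed
    show "P f" if "linear f" "\<And>x. f x $ i = 0" for f i
    proof -
      have "\<not> surj f"
        by (metis surjD that(2) one_neq_zero one_index)
      then have ninj: "\<not> inj f" using linear_injective_imp_surjective[OF that(1)] by blast
      then have "det (matrix f) = 0" using det_nz_iff_inj[OF that(1)] by blast
      moreover have "negligible (f ` S)" for S
        by (rule negligible_linear_singular_image[OF that(1) ninj])
      ultimately show ?thesis by (simp add: P_def negligible_imp_measurable negligible_imp_measure0)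
    qed
    show "P (\<lambda>x. \<chi> i. c i * x $ i)" for c
    proof -
      have "matrix (\<lambda>x. \<chi> i. c i * x $ i) = (\<chi> i j. if i = j then c i else 0)"
        by (simp add: matrix_def axis_def vec_eq_iff)
      then have "det (matrix (\<lambda>x. \<chi> i. c i * x $ i)) = prod c UNIV"
        by (simp add: det_diagonal)
      then show ?thesis unfolding P_def
        using measurable_stretch[of _ c] measure_stretch[of _ c] by simp
    qed
    show "P (\<lambda>x. \<chi> i. x $ Transposition.transpose m n i)" (is "P ?h") if "m \<noteq> n" for m n
    proof (rule boxes)
      let ?p = "Transposition.transpose m n"
      show "linear ?h" by (rule linearI) (simp_all add: vec_eq_iff)
      have "matrix ?h = (\<chi> i. (mat 1 :: real^'n^'n) $ ?p i)"
        by (auto simp: matrix_def mat_def axis_def vec_eq_iff)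
      then show "\<bar>det (matrix ?h)\<bar> = 1"
        by (simp add: det_permute_rows permutes_swap_id sign_swap_id abs_mult)
      fix a b :: "real^'n" assume ne: "cbox a b \<noteq> {}"
      have inv: "?h (?h v) = v" for v by (simp add: vec_eq_iff)
      have mem: "?h v \<in> cbox (?h a) (?h b)" if "v \<in> cbox a b" for a b v :: "real^'n"
        using that by (simp add: mem_box_cart)
      have eq: "?h ` cbox a b = cbox (?h a) (?h b)"
      proof
        show "cbox (?h a) (?h b) \<subseteq> ?h ` cbox a b"
        proof
          fix v assume "v \<in> cbox (?h a) (?h b)"
          then have "?h v \<in> cbox a b" using mem[of v "?h a" "?h b"] unfolding inv by simp
          then show "v \<in> ?h ` cbox a b" using inv[of v] by (metis image_eqI)
        qed
      qed (use mem in blast)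
      then have "cbox (?h a) (?h b) \<noteq> {}" using ne by auto
      then show "measure lebesgue (?h ` cbox a b) = measure lebesgue (cbox a b)"
        using ne prod.permute[OF permutes_swap_id[of m UNIV n], of "\<lambda>i. b $ i - a $ i"]
        by (simp add: eq content_cbox_cart o_def)
    qed
    show "P (\<lambda>x. \<chi> i. if i = m then x $ m + x $ n else x $ i)" (is "P ?h") if mn: "m \<noteq> n" for m n
    proof (rule boxes)
      show lin: "linear ?h" by (rule linearI) (auto simp: vec_eq_iff algebra_simps)
      have "matrix ?h = (\<chi> k. if k = m then row m (mat 1) + 1 *s row n (mat 1) else row k (mat 1 :: real^'n^'n))"
        by (auto simp: matrix_def mat_def axis_def row_def vec_eq_iff)
      then show "\<bar>det (matrix ?h)\<bar> = 1"
        using det_row_operation[OF mn, of "mat 1 :: real^'n^'n" 1] by (simp only: det_I abs_one)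
      fix a b :: "real^'n" assume ne: "cbox a b \<noteq> {}"
      have ne0: "cbox 0 (b - a) \<noteq> {}" using ne by (simp add: interval_ne_empty_cart)
      have "cbox a b = (+) a ` cbox 0 (b - a)" by (simp flip: cbox_translation)
      then have "?h ` cbox a b = (+) (?h a) ` ?h ` cbox 0 (b - a)"
        using linear_add[OF lin] by (auto simp: image_image)
      then show "measure lebesgue (?h ` cbox a b) = measure lebesgue (cbox a b)"
        using measure_shear_interval[OF mn ne0] ne ne0
        by (simp add: measure_translation content_cbox_cart)
    qed
  qed
  then show ?thesis using assms(2) by (simp add: P_def)
qed

section \<open>Lattices and their fundamental cells\<close>

locale lattice =
  fixes \<Gamma> :: "(real^'n::finite) set" and b :: "'n \<Rightarrow> real^'n"
  assumes basis: "lattice_basis b \<Gamma>"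
begin

definition from_coords :: "real^'n \<Rightarrow> real^'n" where
  "from_coords v = (\<Sum>i\<in>UNIV. v $ i *\<^sub>R b i)"

lemma linear_from_coords: "linear from_coords"
  by (rule linearI) (simp_all add: from_coords_def scaleR_add_left sum.distrib scaleR_sum_right)

lemma inj_from_coords: "inj from_coords"
proof -
  have ind: "independent (range b)" and "inj b"
    using basis by (auto simp: lattice_basis_def)
  have "v = 0" if "from_coords v = 0" for v
  proof -
    have "(\<Sum>y\<in>range b. (v $ (inv b y)) *\<^sub>R y) = 0"
      using that \<open>inj b\<close> by (simp add: sum.reindex from_coords_def)
    then have "\<forall>y\<in>range b. v $ (inv b y) = 0"
      using ind by (auto simp: dependent_finite)
    then show "v = 0" using \<open>inj b\<close> by (auto simp: vec_eq_iff)
  qed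
  then show ?thesis using linear_injective_0[OF linear_from_coords] by auto
qed

lemma surj_from_coords: "surj from_coords"
  using linear_injective_imp_surjective[OF linear_from_coords inj_from_coords] by simp

lemma mem_iff: "x \<in> \<Gamma> \<longleftrightarrow> (\<exists>c. x = from_coords (\<chi> i. of_int (c i)))"
  using basis by (auto simp: lattice_basis_def from_coords_def image_iff)

lemma zero_mem: "0 \<in> \<Gamma>"
  unfolding mem_iff by (rule exI[of _ "\<lambda>_. 0"]) (simp add: from_coords_def)

lemma diff_mem: assumes "x \<in> \<Gamma>" "y \<in> \<Gamma>" shows "x - y \<in> \<Gamma>"
proof -
  obtain c d where "x = from_coords (\<chi> i. of_int (c i))" "y = from_coords (\<chi> i. of_int (d i))"
    using assms by (auto simp: mem_iff)
  then have "x - y = from_coords (\<chi> i. of_int (c i - d i))"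
    by (simp add: from_coords_def sum_subtractf scaleR_diff_left)
  then show ?thesis by (auto simp: mem_iff intro!: exI[of _ "\<lambda>i. c i - d i"])
qed

lemma add_mem: "x \<in> \<Gamma> \<Longrightarrow> y \<in> \<Gamma> \<Longrightarrow> x + y \<in> \<Gamma>"
  using diff_mem[of x "0 - y"] diff_mem[OF zero_mem, of y] by simp

lemma scale_mem: assumes "x \<in> \<Gamma>" shows "of_int k *\<^sub>R x \<in> \<Gamma>"
proof -
  obtain c where "x = from_coords (\<chi> i. of_int (c i))" using assms by (auto simp: mem_iff)
  then have "of_int k *\<^sub>R x = from_coords (\<chi> i. of_int (k * c i))"
    by (simp add: from_coords_def scaleR_sum_right)
  then show ?thesis by (auto simp: mem_iff intro!: exI[of _ "\<lambda>i. k * c i"])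
qed

lemma det_from_coords: "\<bar>det (matrix from_coords)\<bar> = \<bar>det (\<chi> i. b i)\<bar>"
proof -
  have "matrix from_coords = transpose (\<chi> i. b i)"
    by (simp add: matrix_def from_coords_def transpose_def vec_eq_iff axis_def if_distrib if_distribR
        cong: if_cong)
  then show ?thesis by simp
qed

text \<open>The matrix of the coordinate map is the transposed basis matrix, so the density is the reciprocal of
  the factor by which this map scales volumes.\<close>

lemma dens_pos: "dens \<Gamma> > 0" and dens_det: "\<bar>det (matrix from_coords)\<bar> = 1 / dens \<Gamma>"
proof -
  have "det (matrix from_coords) \<noteq> 0"
    using inj_from_coords linear_from_coords det_nz_iff_inj by auto
  then show "dens \<Gamma> > 0" "\<bar>det (matrix from_coords)\<bar> = 1 / dens \<Gamma>"
    by (auto simp: dens_eq[OF basis] det_from_coords[symmetric])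
qed

text \<open>The cell is half-open, so that its lattice translates tile the space without any overlap.\<close>

definition cell :: "(real^'n) set" where
  "cell = from_coords ` {v. \<forall>i. 0 \<le> v $ i \<and> v $ i < 1}"

definition cell_radius :: real where
  "cell_radius = (\<Sum>i\<in>UNIV. norm (b i))"

lemma cell_measure: "cell \<in> lmeasurable" "measure lebesgue cell = 1 / dens \<Gamma>"
proof -
  let ?Q = "{v::real^'n. \<forall>i. 0 \<le> v $ i \<and> v $ i < 1}"
  let ?N = "cbox (0::real^'n) 1 - box 0 1"
  have neg: "negligible ?N" by (rule negligible_frontier_interval)
  have sub: "box 0 1 \<subseteq> ?Q" "?Q \<subseteq> cbox 0 1"
    by (auto simp: mem_box_cart less_imp_le)
  have eq: "(?Q - cbox 0 1) \<union> (cbox 0 1 - ?Q) \<subseteq> ?N" using sub by auto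
  have n2: "negligible ((?Q - cbox 0 1) \<union> (cbox 0 1 - ?Q))"
    by (rule negligible_subset[OF neg eq])
  have n3: "negligible ((cbox 0 1 - ?Q) \<union> (?Q - cbox 0 1))"
    using n2 by (simp add: Un_commute)
  have Q: "?Q \<in> lmeasurable"
    by (rule lmeasurable_negligible_symdiff[OF lmeasurable_cbox n3])
  have mQ: "measure lebesgue ?Q = 1"
  proof -
    have "measure lebesgue ?Q = measure lebesgue (cbox (0::real^'n) 1)"
      by (rule measure_negligible_symdiff[OF lmeasurable_cbox n3])
    also have "\<dots> = 1"
      by (simp add: content_cbox_if_cart interval_ne_empty_cart)
    finally show ?thesis .
  qed
  show "cell \<in> lmeasurable" unfolding cell_def
    using lmeasure_linear_image[OF linear_from_coords Q] by blast
  show "measure lebesgue cell = 1 / dens \<Gamma>" unfolding cell_def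
    using lmeasure_linear_image[OF linear_from_coords Q] mQ dens_det by simp
qed

lemma cell_norm: assumes "f \<in> cell" shows "norm f \<le> cell_radius"
proof -
  obtain v where v: "f = from_coords v" "\<And>i. 0 \<le> v $ i \<and> v $ i < 1" using assms by (auto simp: cell_def)
  have "norm f \<le> (\<Sum>i\<in>UNIV. norm (v $ i *\<^sub>R b i))" unfolding v from_coords_def by (rule norm_sum)
  also have "\<dots> \<le> cell_radius" unfolding cell_radius_def
    using v(2) by (intro sum_mono) (simp add: abs_of_nonneg mult_left_le_one_le less_imp_le)
  finally show ?thesis .
qed

lemma cell_covers: obtains x where "x \<in> \<Gamma>" "z - x \<in> cell"
proof -
  obtain v where v: "z = from_coords v" using surj_from_coords by auto
  define x where "x = from_coords (\<chi> i. of_int \<lfloor>v $ i\<rfloor>)"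
  have "z - x = from_coords (v - (\<chi> i. of_int \<lfloor>v $ i\<rfloor>))"
    unfolding x_def v by (simp add: linear_diff[OF linear_from_coords])
  moreover have "\<dots> \<in> cell" unfolding cell_def by (rule imageI) (auto, linarith)
  moreover have "x \<in> \<Gamma>" by (auto simp: mem_iff x_def)
  ultimately show ?thesis using that by metis
qed

lemma cell_disjoint:
  assumes "x \<in> \<Gamma>" "y \<in> \<Gamma>" "z - x \<in> cell" "z - y \<in> cell" shows "x = y"
proof -
  obtain c d where cd: "x = from_coords (\<chi> i. of_int (c i))" "y = from_coords (\<chi> i. of_int (d i))"
    using assms by (auto simp: mem_iff)
  obtain u v where uv: "z - x = from_coords u" "\<And>i. 0 \<le> u $ i \<and> u $ i < 1"
    "z - y = from_coords v" "\<And>i. 0 \<le> v $ i \<and> v $ i < 1" using assms by (auto simp: cell_def)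
  have "from_coords ((\<chi> i. of_int (c i)) + u) = from_coords ((\<chi> i. of_int (d i)) + v)"
    using uv(1,3) cd by (simp add: linear_add[OF linear_from_coords] flip: uv(1,3))
  then have *: "(\<chi> i. of_int (c i)) + u = (\<chi> i. of_int (d i)) + v"
    using inj_from_coords by (auto dest: injD)
  have "c i = d i" for i
  proof -
    have "of_int (c i) + u $ i = of_int (d i) + v $ i"
      using * by (simp add: vec_eq_iff)
    then show ?thesis using uv(2,4)[of i] by linarith
  qed
  then show ?thesis using cd by simp
qed

lemma tiles_measure:
  assumes "finite X" "X \<subseteq> \<Gamma>"
  shows "(\<Union>x\<in>X. (+) x ` cell) \<in> lmeasurable"
    and "measure lebesgue (\<Union>x\<in>X. (+) x ` cell) = real (card X) / dens \<Gamma>"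
proof -
  have meas: "(+) x ` cell \<in> lmeasurable" for x
    by (rule measurable_translation[OF cell_measure(1)])
  show "(\<Union>x\<in>X. (+) x ` cell) \<in> lmeasurable"
    by (intro fmeasurable.finite_UN assms meas)
  have "disjoint_family_on (\<lambda>x. (+) x ` cell) X"
    
  proof (unfold disjoint_family_on_def, intro ballI impI)
    fix x y assume xy: "x \<in> X" "y \<in> X" "x \<noteq> y"
    have False if "z \<in> (+) x ` cell \<inter> (+) y ` cell" for z
    proof -
      have "z - x \<in> cell" "z - y \<in> cell"
        using that by (metis IntD1 IntD2 add_diff_cancel_left' imageE)+
      then show False using cell_disjoint[of x y z] xy assms(2) by auto
    qed
    then show "(+) x ` cell \<inter> (+) y ` cell = {}" by blast
  qed
  then have "measure lebesgue (\<Union>x\<in>X. (+) x ` cell) = (\<Sum>x\<in>X. measure lebesgue ((+) x ` cell))"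
    using meas assms(1)
    by (intro measure_finite_Union fmeasurableD2[folded infinity_ennreal_def] image_subsetI fmeasurableD)
  also have "\<dots> = real (card X) / dens \<Gamma>"
    by (simp add: measure_translation cell_measure(2))
  finally show "measure lebesgue (\<Union>x\<in>X. (+) x ` cell) = real (card X) / dens \<Gamma>" .
qed

text \<open>The constant in the leading term \<open>growth * R ^ CARD('n)\<close> of the number of lattice points in a
  ball of radius \<open>R\<close>.\<close>

definition growth :: real where
  "growth = dens \<Gamma> * measure lborel (ball (0::real^'n) 1)"

lemma growth_pos: "growth > 0"
  using dens_pos by (simp add: growth_def content_ball)

lemma measure_ball: "r \<ge> 0 \<Longrightarrow> dens \<Gamma> * measure lebesgue (ball (c::real^'n) r) = growth * r ^ CARD('n)"
  by (simp add: content_ball growth_def)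

section \<open>Counting lattice points\<close>

text \<open>The cells attached to the lattice points of \<open>S\<close> are disjoint and stay within the ball enlarged
  by the cell radius. Comparing volumes for finite subsets first also shows that \<open>S\<close> contains only
  finitely many lattice points.\<close>

lemma count_upper:
  assumes S: "S \<subseteq> ball c r" and "r \<ge> 0"
  shows "finite (\<Gamma> \<inter> S)" and "real (card (\<Gamma> \<inter> S)) \<le> growth * (r + cell_radius) ^ CARD('n)"
proof -
  have rad: "cell_radius \<ge> 0" by (simp add: cell_radius_def sum_nonneg)
  have bd: "real (card X) \<le> growth * (r + cell_radius) ^ CARD('n)"
    if X: "finite X" "X \<subseteq> \<Gamma> \<inter> S" for X
  proof -
    have "(\<Union>x\<in>X. (+) x ` cell) \<subseteq> ball c (r + cell_radius)"
    proof clarsimp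
      fix x f assume "x \<in> X" "f \<in> cell"
      then have "dist c x < r" "norm f \<le> cell_radius" using S X cell_norm by auto
      then show "dist c (x + f) < r + cell_radius"
        using dist_triangle[of c "x + f" x] by (simp add: dist_norm)
    qed
    then have "measure lebesgue (\<Union>x\<in>X. (+) x ` cell) \<le> measure lebesgue (ball c (r + cell_radius))"
      using tiles_measure(1)[of X] X
      by (intro measure_mono_fmeasurable lmeasurable_ball) (auto dest: fmeasurableD)
    then have "dens \<Gamma> * measure lebesgue (\<Union>x\<in>X. (+) x ` cell)
        \<le> dens \<Gamma> * measure lebesgue (ball c (r + cell_radius))"
      using dens_pos by (intro mult_left_mono) auto
    also have "\<dots> = growth * (r + cell_radius) ^ CARD('n)"
      using rad \<open>r \<ge> 0\<close> by (intro measure_ball) simp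
    finally show ?thesis
      using tiles_measure(2)[of X] X dens_pos by simp
  qed
  have "finite (\<Gamma> \<inter> S) \<and> card (\<Gamma> \<inter> S) \<le> nat \<lfloor>growth * (r + cell_radius) ^ CARD('n)\<rfloor>"
    by (rule finite_if_finite_subsets_card_bdd) (use bd le_nat_floor in blast)
  then show "finite (\<Gamma> \<inter> S)" by simp
  then show "real (card (\<Gamma> \<inter> S)) \<le> growth * (r + cell_radius) ^ CARD('n)"
    using bd by simp
qed

text \<open>Conversely, those cells cover the ball shrunk by the cell radius.\<close>

lemma count_lower:
  assumes S: "ball c r \<subseteq> S" and "r \<ge> cell_radius" and fin: "finite (\<Gamma> \<inter> S)"
  shows "growth * (r - cell_radius) ^ CARD('n) \<le> real (card (\<Gamma> \<inter> S))"
proof -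
  let ?X = "\<Gamma> \<inter> S"
  have "ball c (r - cell_radius) \<subseteq> (\<Union>x\<in>?X. (+) x ` cell)"
  proof
    fix z assume z: "z \<in> ball c (r - cell_radius)"
    obtain x where x: "x \<in> \<Gamma>" "z - x \<in> cell" using cell_covers .
    have "dist c x < r"
      using dist_triangle[of c x z] z cell_norm[OF x(2)] by (simp add: dist_norm)
    then have "x \<in> ?X" using S x by auto
    moreover have "z = x + (z - x)" by simp
    ultimately show "z \<in> (\<Union>x\<in>?X. (+) x ` cell)" using x(2) by (metis UN_I imageI)
  qed
  then have "measure lebesgue (ball c (r - cell_radius)) \<le> measure lebesgue (\<Union>x\<in>?X. (+) x ` cell)"
    using tiles_measure(1)[OF fin] by (intro measure_mono_fmeasurable) auto
  then show ?thesis
    using tiles_measure(2)[OF fin] measure_ball[of "r - cell_radius" c] \<open>r \<ge> cell_radius\<close> dens_pos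
    by (auto simp: field_simps)
qed

end

lemma power_diff_le:
  fixes x y :: real
  assumes "0 \<le> y" "y \<le> x"
  shows "x ^ n - y ^ n \<le> real n * (x - y) * x ^ (n - 1)"
proof (induction n)
  case (Suc n)
  have "x ^ Suc n - y ^ Suc n = x * (x ^ n - y ^ n) + (x - y) * y ^ n"
    by (simp add: algebra_simps)
  also have "\<dots> \<le> x * (real n * (x - y) * x ^ (n - 1)) + (x - y) * x ^ n"
    using assms Suc by (intro add_mono mult_left_mono power_mono) auto
  also have "\<dots> = real (Suc n) * (x - y) * x ^ n"
    by (cases n) (simp_all add: algebra_simps)
  finally show ?case by simp
qed simp

text \<open>A bounded change of the radius changes the main term of a lattice point count by a boundary term.
  The summand \<open>1\<close> covers small radii, where the change stays bounded while \<open>r ^ (n - 1)\<close> may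
  tend to \<open>0\<close>; for \<open>r < s\<close> the shrunk ball is empty, hence the maximum.\<close>

lemma power_perturb:
  fixes s :: real
  assumes "s \<ge> 0" "n \<ge> 1"
  obtains K where "K \<ge> 0"
    "\<And>r. r \<ge> 0 \<Longrightarrow> (r + s) ^ n - r ^ n \<le> K * (r ^ (n - 1) + 1)"
    "\<And>r. r \<ge> 0 \<Longrightarrow> r ^ n - max 0 (r - s) ^ n \<le> K * (r ^ (n - 1) + 1)"
proof
  let ?K = "real n * s * (2 * max 1 s) ^ (n - 1)"
  have big: "real n * s * x \<le> ?K * (r ^ (n - 1) + 1)"
    if "r \<ge> 0" "0 \<le> x" "x \<le> (r + s) ^ (n - 1)" for r x
  proof -
    have "r + s \<le> 2 * max 1 s * max r 1"
    proof -
      have "1 * max r 1 \<le> max 1 s * max r 1" "max 1 s * 1 \<le> max 1 s * max r 1"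
        by (intro mult_right_mono mult_left_mono; simp)+
      then show ?thesis by linarith
    qed
    then have "(r + s) ^ (n - 1) \<le> (2 * max 1 s * max r 1) ^ (n - 1)"
      using that assms by (intro power_mono) auto
    also have "\<dots> = (2 * max 1 s) ^ (n - 1) * max r 1 ^ (n - 1)"
      by (simp only: power_mult_distrib)
    also have "\<dots> \<le> (2 * max 1 s) ^ (n - 1) * (r ^ (n - 1) + 1)"
      using that(1) by (intro mult_left_mono) (auto simp: max_def)
    finally have "real n * s * x \<le> real n * s * ((2 * max 1 s) ^ (n - 1) * (r ^ (n - 1) + 1))"
      using assms that by (intro mult_left_mono) auto
    then show ?thesis by (simp only: mult.assoc)
  qed
  show "?K \<ge> 0" using assms by auto
  show "(r + s) ^ n - r ^ n \<le> ?K * (r ^ (n - 1) + 1)" if "r \<ge> 0" for r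
  proof -
    have "(r + s) ^ n - r ^ n \<le> real n * s * (r + s) ^ (n - 1)"
      using power_diff_le[of r "r + s" n] that assms by simp
    also have "\<dots> \<le> ?K * (r ^ (n - 1) + 1)"
      using that assms by (intro big) auto
    finally show ?thesis .
  qed
  show "r ^ n - max 0 (r - s) ^ n \<le> ?K * (r ^ (n - 1) + 1)" if "r \<ge> 0" for r
  proof -
    have "r ^ n - max 0 (r - s) ^ n \<le> real n * (r - max 0 (r - s)) * r ^ (n - 1)"
      using that assms by (intro power_diff_le) auto
    also have "\<dots> \<le> real n * s * r ^ (n - 1)"
      using that assms by (intro mult_right_mono mult_left_mono) auto
    also have "\<dots> \<le> ?K * (r ^ (n - 1) + 1)"
      using that assms by (intro big power_mono) auto
    finally show ?thesis .
  qed
qed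

section \<open>Contents of lattice points\<close>

context lattice
begin

text \<open>The content as a natural number, with \<open>0\<close> in the place of \<open>\<infinity>\<close>: then divisibility by the
  content describes membership in \<open>l\<Gamma>\<close> uniformly, including the convention that everything divides
  the content of the origin. In coordinates it is the gcd of the coefficients.\<close>

definition cont_nat :: "real^'n \<Rightarrow> nat" where
  "cont_nat x = (SOME g. \<forall>l::nat. x \<in> (\<lambda>y. real l *\<^sub>R y) ` \<Gamma> \<longleftrightarrow> l dvd g)"

lemma content_dvd:
  assumes "x \<in> \<Gamma>"
  shows "l dvd cont_nat x \<longleftrightarrow> x \<in> (\<lambda>y. real l *\<^sub>R y) ` \<Gamma>"
proof -
  obtain c where c: "x = from_coords (\<chi> i. of_int (c i))" using assms mem_iff by auto
  have "x \<in> (\<lambda>y. real l *\<^sub>R y) ` \<Gamma> \<longleftrightarrow> l dvd nat (Gcd (range c))" for l :: nat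
  proof -
    have "x \<in> (\<lambda>y. real l *\<^sub>R y) ` \<Gamma> \<longleftrightarrow> (\<exists>d. x = real l *\<^sub>R from_coords (\<chi> i. of_int (d i)))"
      unfolding image_iff Bex_def mem_iff by blast
    also have "\<dots> \<longleftrightarrow> (\<exists>d. x = from_coords (\<chi> i. of_int (int l * d i)))"
      by (simp add: from_coords_def scaleR_sum_right)
    also have "\<dots> \<longleftrightarrow> (\<exists>d. \<forall>i. c i = int l * d i)"
    proof -
      have "x = from_coords (\<chi> i. of_int (int l * d i)) \<longleftrightarrow> (\<forall>i. c i = int l * d i)" for d
      proof -
        have "x = from_coords (\<chi> i. of_int (int l * d i)) \<longleftrightarrow>
            (\<chi> i. real_of_int (c i)) = (\<chi> i. of_int (int l * d i))"
          unfolding c by (rule inj_eq[OF inj_from_coords])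
        then show ?thesis unfolding vec_eq_iff vec_lambda_beta of_int_eq_iff .
      qed
      then show ?thesis by simp
    qed
    also have "\<dots> \<longleftrightarrow> (\<forall>i. int l dvd c i)"
      unfolding dvd_def choice_iff ..
    also have "\<dots> \<longleftrightarrow> int l dvd Gcd (range c)"
      unfolding dvd_Gcd_iff by blast
    also have "\<dots> \<longleftrightarrow> l dvd nat (Gcd (range c))"
      using int_dvd_int_iff[of l "nat (Gcd (range c))"] by (simp del: int_dvd_int_iff)
    finally show ?thesis .
  qed
  then have "\<forall>l::nat. x \<in> (\<lambda>y. real l *\<^sub>R y) ` \<Gamma> \<longleftrightarrow> l dvd nat (Gcd (range c))" ..
  then have "\<exists>g. \<forall>l::nat. x \<in> (\<lambda>y. real l *\<^sub>R y) ` \<Gamma> \<longleftrightarrow> l dvd g" by (rule exI)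
  from someI_ex[OF this] have "x \<in> (\<lambda>y. real l *\<^sub>R y) ` \<Gamma> \<longleftrightarrow> l dvd cont_nat x"
    unfolding cont_nat_def by (rule spec)
  then show ?thesis by (rule sym)
qed

lemma content_eq_0_iff: "x \<in> \<Gamma> \<Longrightarrow> cont_nat x = 0 \<longleftrightarrow> x = 0"
  using content_dvd[of x 0] zero_mem by (auto simp: image_iff)

lemma cont_eq:
  assumes "x \<in> \<Gamma>"
  shows "cont \<Gamma> x = (if x = 0 then \<infinity> else enat (cont_nat x))"
proof (cases "x = 0")
  case False
  have "cont_nat x > 0" using content_eq_0_iff[OF assms] False by simp
  have "Max {l::nat. l \<ge> 1 \<and> l dvd cont_nat x} = cont_nat x"
  proof (rule Max_eqI)
    show "finite {l::nat. l \<ge> 1 \<and> l dvd cont_nat x}"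
      by (rule finite_subset[of _ "{..cont_nat x}"]) (use \<open>cont_nat x > 0\<close> in \<open>auto dest: dvd_imp_le\<close>)
  qed (use \<open>cont_nat x > 0\<close> in \<open>auto dest: dvd_imp_le\<close>)
  then show ?thesis using False by (simp add: cont_def content_dvd[OF assms])
qed (simp add: cont_def)

lemma visible_iff: "x \<in> visible \<Gamma> \<longleftrightarrow> x \<in> \<Gamma> \<and> cont_nat x = 1"
  using content_eq_0_iff[of x] by (auto simp: visible_def cont_eq one_enat_def)

lemma prime_dvd_cont_iff:
  assumes "x \<in> \<Gamma>" "prime p"
  shows "enat p dvd cont \<Gamma> x \<longleftrightarrow> p dvd cont_nat x"
  using assms prime_dvd_infinity[OF assms(2)] content_eq_0_iff[of x]
  by (auto simp: cont_eq enat_dvd_enat_iff)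

lemma content_dvd_diff:
  assumes "x \<in> \<Gamma>" "y \<in> \<Gamma>" "l dvd cont_nat x" "l dvd cont_nat y"
  shows "l dvd cont_nat (x - y)"
proof -
  obtain u v where "u \<in> \<Gamma>" "v \<in> \<Gamma>" "x = real l *\<^sub>R u" "y = real l *\<^sub>R v"
    using assms by (auto simp: content_dvd)
  then have "x - y = real l *\<^sub>R (u - v)" "u - v \<in> \<Gamma>"
    by (auto simp: scaleR_diff_right diff_mem)
  then show ?thesis using content_dvd[OF diff_mem[OF assms(1,2)]] by blast
qed

lemma content_dvd_scale:
  assumes "x \<in> \<Gamma>" "int l dvd k"
  shows "l dvd cont_nat (of_int k *\<^sub>R x)"
proof -
  obtain j where "k = int l * j" using assms by auto
  then have "of_int k *\<^sub>R x = real l *\<^sub>R (of_int j *\<^sub>R x)" by simp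
  then show ?thesis using content_dvd[OF scale_mem[OF assms(1), of k]] scale_mem[OF assms(1), of j] by blast
qed

text \<open>A linear injection is bounded below, and a nonzero integer vector has norm at least \<open>1\<close>.\<close>

lemma min_norm: obtains \<delta> where "\<delta> > 0" "\<And>x. x \<in> \<Gamma> \<Longrightarrow> x \<noteq> 0 \<Longrightarrow> \<delta> \<le> norm x"
proof -
  obtain B where B: "B > 0" "\<And>v. B * norm v \<le> norm (from_coords v)"
    using linear_inj_bounded_below_pos[OF linear_from_coords inj_from_coords] by blast
  have "B \<le> norm x" if x: "x \<in> \<Gamma>" "x \<noteq> 0" for x
  proof -
    obtain c where c: "x = from_coords (\<chi> i. of_int (c i))" using x mem_iff by auto
    have "\<exists>i. c i \<noteq> 0"
    proof (rule ccontr)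
      assume "\<not> (\<exists>i. c i \<noteq> 0)"
      then show False using x(2) c by (simp add: from_coords_def)
    qed
    then obtain i where i: "c i \<noteq> 0" by blast
    have "1 \<le> norm ((\<chi> i. real_of_int (c i)) $ i)" using i by auto
    also have "\<dots> \<le> norm (\<chi> i. real_of_int (c i))" by (rule Finite_Cartesian_Product.norm_nth_le)
    finally have "B * 1 \<le> B * norm (\<chi> i. real_of_int (c i))" using B(1) by (intro mult_left_mono) auto
    then show ?thesis using B(2)[of "\<chi> i. real_of_int (c i)"] c by simp
  qed
  then show ?thesis using B(1) that by blast
qed

lemma uniform_discrete: "uniform_discrete \<Gamma>"
proof -
  obtain \<delta> where d: "\<delta> > 0" "\<And>x. x \<in> \<Gamma> \<Longrightarrow> x \<noteq> 0 \<Longrightarrow> \<delta> \<le> norm x"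
    using min_norm by metis
  show ?thesis unfolding uniform_discrete_def
  proof (intro exI[of _ \<delta>] conjI ballI impI d(1))
    fix x y assume "x \<in> \<Gamma>" "y \<in> \<Gamma>" "dist x y < \<delta>"
    then show "x = y" using d(2)[OF diff_mem, of x y] by (auto simp: dist_norm)
  qed
qed

text \<open>A point of content \<open>l\<close> is \<open>l\<close> times a nonzero lattice point. This is what makes the
  inclusion-exclusion over divisors finite for points in a given ball.\<close>

lemma content_le_norm:
  obtains \<delta> where "\<delta> > 0" "\<And>x. x \<in> \<Gamma> \<Longrightarrow> x \<noteq> 0 \<Longrightarrow> \<delta> * real (cont_nat x) \<le> norm x"
proof -
  obtain \<delta> where d: "\<delta> > 0" "\<And>x. x \<in> \<Gamma> \<Longrightarrow> x \<noteq> 0 \<Longrightarrow> \<delta> \<le> norm x"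
    using min_norm by metis
  have "\<delta> * real (cont_nat x) \<le> norm x" if x: "x \<in> \<Gamma>" "x \<noteq> 0" for x
  proof -
    obtain y where y: "y \<in> \<Gamma>" "x = real (cont_nat x) *\<^sub>R y"
      using content_dvd[OF x(1), of "cont_nat x"] by auto
    then have "y \<noteq> 0" using x by auto
    then have "real (cont_nat x) * \<delta> \<le> real (cont_nat x) * norm y"
      using d(2)[OF y(1)] by (intro mult_left_mono) auto
    also have "\<dots> = norm x" by (subst y(2)) simp
    finally show ?thesis by (simp add: mult.commute)
  qed
  then show ?thesis using d(1) that by blast
qed

lemma finite_norm_less: "finite {x \<in> \<Gamma>. norm x < R}"
proof (cases "R \<ge> 0")
  case True
  have "finite (\<Gamma> \<inter> ball 0 R)" by (rule count_upper(1)[OF subset_refl True])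
  moreover have "{x \<in> \<Gamma>. norm x < R} = \<Gamma> \<inter> ball 0 R" by auto
  ultimately show ?thesis by simp
next
  case False
  have "\<not> norm x < R" for x :: "real^'n"
    using False norm_ge_zero[of x] by linarith
  then show ?thesis by simp
qed

text \<open>Rescaling the coset \<open>t + m\<Gamma>\<close> to \<open>\<Gamma>\<close> turns the intersection of the two balls of radius \<open>R\<close> into a
  set between balls of radii \<open>R / m - norm a\<close> and \<open>R / m\<close> about the same centre. The
  constant does not depend on \<open>m\<close> or \<open>t\<close>, which allows summation over all cosets.\<close>

lemma count_coset:
  obtains K where "K \<ge> 0"
    "\<And>m R t. m \<ge> (1::nat) \<Longrightarrow> R \<ge> 0 \<Longrightarrow> t \<in> \<Gamma> \<Longrightarrow>
      \<bar>real (card {x \<in> \<Gamma>. norm x < R \<and> norm (x - a) < R \<and> m dvd cont_nat (x - t)})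
        - growth * (R / m) ^ CARD('n)\<bar> \<le> K * ((R / m) ^ (CARD('n) - 1) + 1)"
proof -
  let ?n = "CARD('n)"
  define s where "s = norm a + cell_radius"
  have rad: "cell_radius \<ge> 0" by (simp add: cell_radius_def sum_nonneg)
  then have s0: "s \<ge> 0" by (simp add: s_def)
  have n1: "?n \<ge> 1" using finite_UNIV_card_ge_0[where 'a='n] by simp
  obtain K where K: "K \<ge> 0"
    "\<And>r. r \<ge> 0 \<Longrightarrow> (r + s) ^ ?n - r ^ ?n \<le> K * (r ^ (?n - 1) + 1)"
    "\<And>r. r \<ge> 0 \<Longrightarrow> r ^ ?n - max 0 (r - s) ^ ?n \<le> K * (r ^ (?n - 1) + 1)"
    using power_perturb[OF s0 n1] by metis
  have main: "\<bar>real (card {x \<in> \<Gamma>. norm x < R \<and> norm (x - a) < R \<and> m dvd cont_nat (x - t)})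
        - growth * (R / m) ^ ?n\<bar> \<le> growth * K * ((R / m) ^ (?n - 1) + 1)" (is "\<bar>real (card ?X) - _\<bar> \<le> _")
    if m: "m \<ge> (1::nat)" and R: "R \<ge> 0" and t: "t \<in> \<Gamma>" for m R t
  proof -
    define r where "r = R / m"
    have r: "r \<ge> 0" "R = m * r" using R m by (auto simp: r_def)
    define S where "S = {y. norm (t + real m *\<^sub>R y) < R \<and> norm (t + real m *\<^sub>R y - a) < R}"
    define c where "c = - (1 / real m) *\<^sub>R t"
    have norm_eq: "norm (t + real m *\<^sub>R y) = real m * norm (y - c)" for y
    proof -
      have "t + real m *\<^sub>R y = real m *\<^sub>R (y - c)" using m by (simp add: c_def scaleR_add_right)
      then show ?thesis by simp
    qed
    have "?X = (\<lambda>y. t + real m *\<^sub>R y) ` (\<Gamma> \<inter> S)"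
    proof (rule set_eqI, rule iffI)
      fix x assume x: "x \<in> ?X"
      then obtain y where "y \<in> \<Gamma>" "x - t = real m *\<^sub>R y"
        using content_dvd[OF diff_mem[OF _ t]] by auto
      then have "x = t + real m *\<^sub>R y" by (simp add: algebra_simps)
      then show "x \<in> (\<lambda>y. t + real m *\<^sub>R y) ` (\<Gamma> \<inter> S)" using x \<open>y \<in> \<Gamma>\<close> by (auto simp: S_def)
    next
      fix x assume "x \<in> (\<lambda>y. t + real m *\<^sub>R y) ` (\<Gamma> \<inter> S)"
      then obtain y where y: "y \<in> \<Gamma>" "y \<in> S" "x = t + real m *\<^sub>R y" by auto
      have "real m *\<^sub>R y \<in> \<Gamma>" using scale_mem[OF y(1), of "int m"] by simp
      moreover have "m dvd cont_nat (real m *\<^sub>R y)" using content_dvd_scale[OF y(1), of m "int m"] by simp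
      ultimately show "x \<in> ?X" using y t add_mem by (auto simp: S_def)
    qed
    moreover have "inj_on (\<lambda>y. t + real m *\<^sub>R y) (\<Gamma> \<inter> S)"
      using m by (auto simp: inj_on_def)
    ultimately have card: "card ?X = card (\<Gamma> \<inter> S)" by (simp add: card_image)
    have up: "S \<subseteq> ball c r"
    proof
      fix y assume "y \<in> S"
      then have "real m * norm (y - c) < real m * r" using r by (simp add: S_def norm_eq)
      then show "y \<in> ball c r" using m by (simp add: dist_norm norm_minus_commute)
    qed
    have low: "ball c (r - norm a) \<subseteq> S"
    proof
      fix y assume "y \<in> ball c (r - norm a)"
      then have "norm (y - c) < r - norm a" by (simp add: dist_norm norm_minus_commute)
      then have *: "real m * norm (y - c) < real m * (r - norm a)" using m by simp
      have "norm a \<le> real m * norm a" using m mult_right_mono[of 1 "real m" "norm a"] by simp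
      then have "real m * norm (y - c) + norm a < R" using * r by (simp add: algebra_simps)
      moreover have "norm (t + real m *\<^sub>R y - a) \<le> real m * norm (y - c) + norm a"
        using norm_triangle_ineq4[of "t + real m *\<^sub>R y" a] by (simp add: norm_eq)
      ultimately show "y \<in> S" using norm_ge_zero[of a] unfolding S_def norm_eq mem_Collect_eq by linarith
    qed
    have "real (card ?X) \<le> growth * (r + cell_radius) ^ ?n"
      unfolding card by (rule count_upper(2)[OF up r(1)])
    also have "\<dots> \<le> growth * (r + s) ^ ?n"
      using growth_pos r rad by (intro mult_left_mono power_mono) (auto simp: s_def)
    also have "\<dots> \<le> growth * (r ^ ?n + K * (r ^ (?n - 1) + 1))"
      using growth_pos K(2)[OF r(1)] by (intro mult_left_mono) auto
    finally have upper: "real (card ?X) \<le> growth * r ^ ?n + growth * K * (r ^ (?n - 1) + 1)"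
      by (simp add: algebra_simps)
    have "growth * max 0 (r - s) ^ ?n \<le> real (card ?X)"
    proof (cases "r - s \<ge> 0")
      case True
      have "growth * (r - norm a - cell_radius) ^ ?n \<le> real (card ?X)"
        unfolding card using True by (intro count_lower[OF low _ count_upper(1)[OF up r(1)]]) (simp add: s_def)
      then show ?thesis using True by (simp add: s_def algebra_simps)
    next
      case False
      then have "max 0 (r - s) = 0" by simp
      then show ?thesis using n1 by (simp add: zero_power)
    qed
    moreover have "growth * (r ^ ?n - K * (r ^ (?n - 1) + 1)) \<le> growth * max 0 (r - s) ^ ?n"
      using growth_pos K(3)[OF r(1)] by (intro mult_left_mono) auto
    ultimately have "growth * r ^ ?n - growth * K * (r ^ (?n - 1) + 1) \<le> real (card ?X)"
      by (simp add: algebra_simps)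
    then show ?thesis using upper by (simp add: r_def abs_le_iff)
  qed
  show ?thesis
    by (rule that[of "growth * K"]) (use K(1) growth_pos main in auto)
qed

end

section \<open>Inclusion-exclusion over finite sets of primes\<close>

text \<open>A squarefree number \<open>d\<close> is represented by the set of its primes, and its Moebius value by
  \<open>(-1) ^ card A\<close>. Inclusion-exclusion is then the expansion of a product over a finite set.\<close>

definition prime_sets :: "nat set set" where
  "prime_sets = {A. finite A \<and> (\<forall>p\<in>A. prime p)}"

lemma prime_sets_D: "A \<in> prime_sets \<Longrightarrow> finite A" "A \<in> prime_sets \<Longrightarrow> p \<in> A \<Longrightarrow> prime p"
  by (auto simp: prime_sets_def)

lemma prime_sets_prod_pos: "A \<in> prime_sets \<Longrightarrow> \<Prod>A > 0"
  by (auto simp: prime_sets_def intro!: prod_pos prime_gt_0_nat)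

lemma prime_factors_prod_prime_set: "A \<in> prime_sets \<Longrightarrow> prime_factors (\<Prod>A) = A"
  by (subst prime_factors_prod) (auto simp: prime_sets_def prime_prime_factors)

lemma inj_on_prod_prime_sets: "inj_on (\<lambda>A. \<Prod>A) prime_sets"
  by (metis inj_onI prime_factors_prod_prime_set)

lemma coprime_prod_prime_sets:
  assumes "A \<in> prime_sets" "B \<in> prime_sets" "A \<inter> B = {}"
  shows "coprime (\<Prod>A) (\<Prod>B)"
proof (intro prod_coprime_left prod_coprime_right)
  fix p q assume "p \<in> A" "q \<in> B"
  then show "coprime p q" using assms by (intro primes_coprime) (auto simp: prime_sets_def)
qed

lemma prod_prime_set_dvd_iff:
  assumes "A \<in> prime_sets"
  shows "\<Prod>A dvd m \<longleftrightarrow> (\<forall>p\<in>A. p dvd m)"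
proof
  have "finite A" "\<forall>p\<in>A. prime p" using assms by (auto simp: prime_sets_def)
  then show "\<Prod>A dvd m" if "\<forall>p\<in>A. p dvd m" using that
  proof (induction A rule: finite_induct)
    case (insert p A)
    have "coprime p (\<Prod>A)"
      using insert by (intro prod_coprime_right primes_coprime) auto
    then show ?case using insert by (simp add: divides_mult)
  qed simp
  show "\<forall>p\<in>A. p dvd m" if "\<Prod>A dvd m"
    using that \<open>finite A\<close> by (meson dvd_prod_eqI dvd_trans dvd_prodI)
qed

text \<open>Moebius inversion: expand \<open>(-1 + 1) ^ card Q\<close>.\<close>

lemma sum_signs_Pow:
  assumes "finite Q"
  shows "(\<Sum>A\<in>Pow Q. (-1::real) ^ card A) = (if Q = {} then 1 else 0)"
proof -
  have "(\<Prod>p\<in>Q. -1 + 1 :: real) = (\<Sum>A\<in>Pow Q. (\<Prod>p\<in>A. -1) * (\<Prod>p\<in>Q - A. 1))"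
    by (rule prod_add[OF assms])
  then show ?thesis using assms by (auto simp: power_0_left)
qed

abbreviation pair_prod :: "nat set \<times> nat set \<Rightarrow> nat" where
  "pair_prod AB \<equiv> \<Prod>(fst AB) * \<Prod>(snd AB)"

abbreviation pair_sign :: "nat set \<times> nat set \<Rightarrow> real" where
  "pair_sign AB \<equiv> (-1) ^ (card (fst AB) + card (snd AB))"

text \<open>The products of distinct sets of primes are distinct natural numbers, so the sum is dominated by
  \<open>\<Sum>m. 1 / m ^ k\<close>.\<close>

lemma summable_prime_sets:
  assumes "k \<ge> 2"
  shows "(\<lambda>A. 1 / real (\<Prod>A) ^ k) summable_on prime_sets"
proof -
  have "summable (\<lambda>m. 1 / real m ^ k)"
    using inverse_power_summable[OF assms, where 'a=real] by (simp add: inverse_eq_divide power_one_over)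
  then have "(\<lambda>m. 1 / real m ^ k) summable_on UNIV"
    by (subst summable_on_UNIV_nonneg_real_iff) auto
  then have "(\<lambda>m. 1 / real m ^ k) summable_on ((\<lambda>A. \<Prod>A) ` prime_sets)"
    by (rule summable_on_subset) auto
  then show ?thesis
    by (subst (asm) summable_on_reindex[OF inj_on_prod_prime_sets]) (simp add: o_def)
qed

lemma summable_prime_set_pairs:
  assumes "k \<ge> 2"
  shows "(\<lambda>AB. 1 / real (pair_prod AB) ^ k) summable_on (prime_sets \<times> prime_sets)"
proof -
  let ?f = "\<lambda>A::nat set. 1 / real (\<Prod>A) ^ k"
  have s: "?f summable_on prime_sets" by (rule summable_prime_sets[OF assms])
  have "(\<lambda>(A, B). ?f A * ?f B) summable_on (prime_sets \<times> prime_sets)"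
  proof (rule summable_on_SigmaI)
    show "((\<lambda>B. case (A, B) of (A, B) \<Rightarrow> ?f A * ?f B) has_sum ?f A * infsum ?f prime_sets) prime_sets" for A
      using has_sum_cmult_right[OF has_sum_infsum[OF s], of "?f A"] by simp
    show "(\<lambda>A. ?f A * infsum ?f prime_sets) summable_on prime_sets"
      by (rule summable_on_cmult_left[OF s])
  qed (auto intro!: mult_nonneg_nonneg zero_le_power prod_nonneg)
  then show ?thesis
    by (rule summable_on_cong[THEN iffD1, rotated]) (auto simp: power_mult_distrib)
qed

text \<open>The pairs that index the inclusion-exclusion: \<open>A\<close> collects primes dividing the content of
  \<open>x\<close>, and \<open>B\<close> primes dividing the content of \<open>x - a\<close>. With \<open>P\<close> the divisors of the content of
  \<open>a\<close>, a prime of \<open>P\<close> divides the content of \<open>x\<close> if and only if it divides that of \<open>x - a\<close>, so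
  it is recorded in \<open>A\<close> only; a prime outside \<open>P\<close> cannot divide both, so the sets are disjoint. This
  treats \<open>a = 0\<close> on the same footing as all other differences, with \<open>B = {}\<close> throughout.\<close>

definition admissible :: "nat set \<Rightarrow> (nat set \<times> nat set) set" where
  "admissible P = {(A, B). A \<in> prime_sets \<and> B \<in> prime_sets \<and> A \<inter> B = {} \<and> B \<inter> P = {}}"

lemma admissible_subset: "admissible P \<subseteq> prime_sets \<times> prime_sets"
  by (auto simp: admissible_def)

lemma pair_prod_pos: "AB \<in> admissible P \<Longrightarrow> pair_prod AB > 0"
  using prime_sets_prod_pos by (auto simp: admissible_def)

text \<open>Each factor contributes \<open>1\<close>, \<open>f p\<close> or \<open>h p\<close>; \<open>A\<close> and \<open>B\<close> record where the second and the third
  are chosen.\<close>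

lemma prod_expand_disjoint_pairs:
  fixes f h :: "'a \<Rightarrow> 'b::comm_ring_1"
  assumes "finite Q"
  shows "(\<Prod>p\<in>Q. 1 + f p + h p) =
    (\<Sum>(A, B) | A \<subseteq> Q \<and> B \<subseteq> Q \<and> A \<inter> B = {}. (\<Prod>p\<in>A. f p) * (\<Prod>p\<in>B. h p))"
proof -
  have "(\<Prod>p\<in>Q. f p + (h p + 1)) = (\<Sum>A\<in>Pow Q. (\<Prod>p\<in>A. f p) * (\<Prod>p\<in>Q - A. h p + 1))"
    by (rule prod_add[OF assms])
  also have "\<dots> = (\<Sum>A\<in>Pow Q. \<Sum>B\<in>Pow (Q - A). (\<Prod>p\<in>A. f p) * (\<Prod>p\<in>B. h p))"
    using assms by (intro sum.cong refl) (simp add: prod_add sum_distrib_left)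
  also have "\<dots> = (\<Sum>(A, B)\<in>Sigma (Pow Q) (\<lambda>A. Pow (Q - A)). (\<Prod>p\<in>A. f p) * (\<Prod>p\<in>B. h p))"
    using assms by (intro sum.Sigma) auto
  also have "Sigma (Pow Q) (\<lambda>A. Pow (Q - A)) = {(A, B). A \<subseteq> Q \<and> B \<subseteq> Q \<and> A \<inter> B = {}}"
    by auto
  finally show ?thesis by (simp add: algebra_simps)
qed

text \<open>The proportion of lattice points \<open>x\<close> for which \<open>x\<close> and \<open>x - a\<close> are both visible, as it comes
  out of inclusion-exclusion.\<close>

definition pair_density :: "nat \<Rightarrow> nat set \<Rightarrow> real" where
  "pair_density n P = (\<Sum>\<^sub>\<infinity>AB\<in>admissible P. pair_sign AB / real (pair_prod AB) ^ n)"

lemma pair_density_has_sum: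
  assumes "n \<ge> 2"
  shows "((\<lambda>AB. pair_sign AB / real (pair_prod AB) ^ n) has_sum pair_density n P) (admissible P)"
proof -
  have "(\<lambda>AB. 1 / real (pair_prod AB) ^ n) summable_on admissible P"
    by (rule summable_on_subset[OF summable_prime_set_pairs[OF assms] admissible_subset])
  then have "(\<lambda>AB. norm (pair_sign AB / real (pair_prod AB) ^ n)) summable_on admissible P"
    by (rule summable_on_cong[THEN iffD1, rotated])
      (simp add: abs_mult power_abs del: of_nat_mult of_nat_prod)
  then show ?thesis unfolding pair_density_def
    by (rule has_sum_infsum[OF abs_summable_summable])
qed

text \<open>The partial Euler products are the sums over the pairs of sets of primes up to \<open>N\<close>, and these
  finite index sets exhaust all admissible pairs.\<close>

lemma euler_product_tendsto_pair_density:
  assumes "n \<ge> 2"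
  shows "(\<lambda>N. \<Prod>p | prime p \<and> p \<le> N. 1 - 1 / real p ^ n - (if p \<in> P then 0 else 1 / real p ^ n))
    \<longlonglongrightarrow> pair_density n P"
proof -
  define Q where "Q N = {p::nat. prime p \<and> p \<le> N}" for N
  define D where "D N = {AB \<in> admissible P. fst AB \<subseteq> Q N \<and> snd AB \<subseteq> Q N}" for N
  have finQ: "finite (Q N)" for N by (rule finite_subset[of _ "{..N}"]) (auto simp: Q_def)
  have finD: "finite (D N)" for N
    by (rule finite_subset[of _ "Pow (Q N) \<times> Pow (Q N)"]) (use finQ in \<open>auto simp: D_def\<close>)
  have "filterlim D (finite_subsets_at_top (admissible P)) sequentially"
    unfolding filterlim_finite_subsets_at_top
  proof safe
    fix X assume X: "finite X" "X \<subseteq> admissible P"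
    define M where "M = Max (\<Union>(fst ` X) \<union> \<Union>(snd ` X) \<union> {0})"
    have fin: "finite (\<Union>(fst ` X) \<union> \<Union>(snd ` X) \<union> {0})"
      using X by (fastforce simp: admissible_def prime_sets_def)
    have sub: "X \<subseteq> D N" if "N \<ge> M" for N
    proof
      fix AB assume AB: "AB \<in> X"
      have "p \<le> N" if "p \<in> fst AB \<union> snd AB" for p
      proof -
        have "p \<le> M" unfolding M_def using that AB by (intro Max_ge fin) auto
        then show ?thesis using \<open>N \<ge> M\<close> by simp
      qed
      moreover have adm: "AB \<in> admissible P" using AB X by blast
      moreover have "prime p" if "p \<in> fst AB \<union> snd AB" for p
        using adm that by (auto simp: admissible_def prime_sets_def)
      ultimately show "AB \<in> D N" unfolding D_def Q_def by blast
    qed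
    show "\<forall>\<^sub>F N in sequentially. finite (D N) \<and> X \<subseteq> D N \<and> D N \<subseteq> admissible P"
      by (rule eventually_sequentiallyI[of M]) (use sub finD in \<open>auto simp: D_def\<close>)
  qed
  then have lim: "(\<lambda>N. \<Sum>AB\<in>D N. pair_sign AB / real (pair_prod AB) ^ n) \<longlonglongrightarrow> pair_density n P"
    using pair_density_has_sum[OF assms, of P] unfolding has_sum_def by (rule filterlim_compose[rotated])
  have "(\<Sum>AB\<in>D N. pair_sign AB / real (pair_prod AB) ^ n) =
      (\<Prod>p\<in>Q N. 1 - 1 / real p ^ n - (if p \<in> P then 0 else 1 / real p ^ n))" for N
  proof -
    let ?f = "\<lambda>p::nat. - (1 / real p ^ n)" and ?h = "\<lambda>p. if p \<in> P then 0 else - (1 / real p ^ n)"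
    let ?E = "{(A, B). A \<subseteq> Q N \<and> B \<subseteq> Q N \<and> A \<inter> B = {}}"
    have finE: "finite ?E"
      by (rule finite_subset[of _ "Pow (Q N) \<times> Pow (Q N)"]) (use finQ in auto)
    have prodf: "(\<Prod>p\<in>A. ?f p) = (-1) ^ card A / real (\<Prod>A) ^ n" for A
    proof -
      have "(\<Prod>p\<in>A. ?f p) = (\<Prod>p\<in>A. (-1) * (1 / real p ^ n))" by simp
      also have "\<dots> = (\<Prod>p\<in>A. (-1)) * (\<Prod>p\<in>A. 1 / real p ^ n)" by (rule prod.distrib)
      also have "\<dots> = (-1) ^ card A * (1 / real (\<Prod>A) ^ n)"
        by (simp add: prod_dividef prod_power_distrib)
      finally show ?thesis by simp
    qed
    have "(\<Prod>p\<in>Q N. 1 - 1 / real p ^ n - (if p \<in> P then 0 else 1 / real p ^ n)) = (\<Prod>p\<in>Q N. 1 + ?f p + ?h p)"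
      by (intro prod.cong) auto
    also have "\<dots> = (\<Sum>(A, B)\<in>?E. (\<Prod>p\<in>A. ?f p) * (\<Prod>p\<in>B. ?h p))"
      by (rule prod_expand_disjoint_pairs[OF finQ])
    also have "\<dots> = (\<Sum>(A, B)\<in>D N. (\<Prod>p\<in>A. ?f p) * (\<Prod>p\<in>B. ?h p))"
    proof (rule sum.mono_neutral_right[OF finE])
      show "D N \<subseteq> ?E" by (auto simp: D_def admissible_def)
      show "\<forall>AB\<in>?E - D N. (case AB of (A, B) \<Rightarrow> (\<Prod>p\<in>A. ?f p) * (\<Prod>p\<in>B. ?h p)) = 0"
      proof (intro ballI, clarify)
        fix A B assume AB: "(A, B) \<notin> D N" "A \<subseteq> Q N" "B \<subseteq> Q N" "A \<inter> B = {}"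
        then have fin: "finite A" "finite B" using finQ finite_subset by blast+
        then have "A \<in> prime_sets" "B \<in> prime_sets" using AB by (auto simp: prime_sets_def Q_def)
        then obtain p where "p \<in> B" "p \<in> P" using AB by (auto simp: D_def admissible_def)
        then have "(\<Prod>p\<in>B. ?h p) = 0" using fin by (intro prod_zero) auto
        then show "(\<Prod>p\<in>A. ?f p) * (\<Prod>p\<in>B. ?h p) = 0" by (simp only: mult_zero_right)
      qed
    qed
    also have "\<dots> = (\<Sum>AB\<in>D N. pair_sign AB / real (pair_prod AB) ^ n)"
    proof (intro sum.cong refl, clarify)
      fix A B assume "(A, B) \<in> D N"
      then have "B \<inter> P = {}" by (auto simp: D_def admissible_def)
      then have "(\<Prod>p\<in>B. ?h p) = (\<Prod>p\<in>B. ?f p)" by (intro prod.cong) auto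
      then show "(\<Prod>p\<in>A. ?f p) * (\<Prod>p\<in>B. ?h p) = pair_sign (A, B) / real (pair_prod (A, B)) ^ n"
        unfolding prodf by (simp add: power_add power_mult_distrib)
    qed
    finally show ?thesis by simp
  qed
  with lim show ?thesis by (simp add: Q_def)
qed

lemma prime_power_ge: "prime (p::nat) \<Longrightarrow> n \<ge> 2 \<Longrightarrow> real p ^ n \<ge> 4"
proof -
  assume "prime p" "n \<ge> 2"
  have "(2::real) ^ 2 \<le> 2 ^ n" using \<open>n \<ge> 2\<close> by (intro power_increasing) auto
  also have "\<dots> \<le> real p ^ n" using prime_ge_2_nat[OF \<open>prime p\<close>] by (intro power_mono) auto
  finally show ?thesis by simp
qed

text \<open>With \<open>q = 1 / p ^ n\<close>, the local factor of the weight formula is \<open>1 - 2 * q\<close>, and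
  \<open>(1 - 2 * q) * (1 + 1 / (p ^ n - 2)) = 1 - q\<close>. These are the factors of the Euler product of
  \<open>pair_density\<close> for \<open>p\<close> outside and inside \<open>P\<close>.\<close>

lemma pair_density_eq_prodinf:
  assumes "n \<ge> 2"
  shows "pair_density n {p. P p} = xi (real n) *
    (\<Prod>p. if prime p \<and> P p then 1 + 1 / (real p ^ n - 2) else 1)"
proof -
  let ?x = "\<lambda>p::nat. if prime p then 1 - 2 / (real p powr real n) else 1"
  let ?y = "\<lambda>p::nat. if prime p \<and> P p then 1 + 1 / (real p ^ n - 2) else 1"
  have sm: "summable (\<lambda>m. 2 * (1 / real m ^ n))"
    using inverse_power_summable[OF assms, where 'a=real]
    by (intro summable_mult) (simp add: inverse_eq_divide power_one_over)
  have powr: "real p powr real n = real p ^ n" if "prime p" for p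
    using prime_gt_0_nat[OF that] by (simp add: powr_realpow)
  have "summable (\<lambda>p. norm (?x p - 1))"
    by (rule summable_comparison_test'[OF sm, of 0]) (auto simp: powr)
  then have x: "convergent_prod ?x"
    by (intro abs_convergent_prod_imp_convergent_prod summable_imp_abs_convergent_prod)
  have "summable (\<lambda>p. norm (?y p - 1))"
  proof (rule summable_comparison_test'[OF sm, of 0])
    fix p :: nat
    show "norm (norm (?y p - 1)) \<le> 2 * (1 / real p ^ n)"
    proof (cases "prime p \<and> P p")
      case True
      then have "real p ^ n \<ge> 4" using prime_power_ge assms by blast
      moreover have "1 / (q - 2) \<le> 2 / q" if "q \<ge> 4" for q :: real
        using that by (simp add: divide_simps)
      ultimately have "1 / (real p ^ n - 2) \<le> 2 / real p ^ n" by blast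
      moreover have "0 \<le> 1 / (real p ^ n - 2)" using \<open>real p ^ n \<ge> 4\<close> by simp
      ultimately show ?thesis using True
        by (simp only: if_True simp_thms add_diff_cancel_left' real_norm_def abs_of_nonneg)
    qed auto
  qed
  then have y: "convergent_prod ?y"
    by (intro abs_convergent_prod_imp_convergent_prod summable_imp_abs_convergent_prod)
  have "(\<lambda>N. (\<Prod>p\<le>N. ?x p) * (\<Prod>p\<le>N. ?y p)) \<longlonglongrightarrow> prodinf ?x * prodinf ?y"
    by (intro tendsto_mult convergent_prod_LIMSEQ x y)
  moreover have "(\<Prod>p\<le>N. ?x p) * (\<Prod>p\<le>N. ?y p) =
     (\<Prod>p | prime p \<and> p \<le> N. 1 - 1 / real p ^ n - (if p \<in> {p. P p} then 0 else 1 / real p ^ n))" for N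
  proof -
    have "(\<Prod>p\<le>N. ?x p) * (\<Prod>p\<le>N. ?y p) = (\<Prod>p\<le>N. if prime p
        then 1 - 1 / real p ^ n - (if p \<in> {p. P p} then 0 else 1 / real p ^ n) else 1)"
      unfolding prod.distrib[symmetric]
    proof (intro prod.cong refl)
      fix p
      show "?x p * ?y p = (if prime p
        then 1 - 1 / real p ^ n - (if p \<in> {p. P p} then 0 else 1 / real p ^ n) else 1)"
        using prime_power_ge[of p n] assms by (auto simp: powr field_simps)
    qed
    also have "\<dots> = (\<Prod>p\<in>{p\<in>{..N}. prime p}.
        1 - 1 / real p ^ n - (if p \<in> {p. P p} then 0 else 1 / real p ^ n))"
      by (rule prod.inter_filter[symmetric]) simp
    also have "{p\<in>{..N}. prime p} = {p. prime p \<and> p \<le> N}" by auto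
    finally show ?thesis .
  qed
  ultimately have "(\<lambda>N. \<Prod>p | prime p \<and> p \<le> N. 1 - 1 / real p ^ n - (if p \<in> {p. P p} then 0 else 1 / real p ^ n))
     \<longlonglongrightarrow> prodinf ?x * prodinf ?y" by simp
  then show ?thesis
    using LIMSEQ_unique[OF euler_product_tendsto_pair_density[OF assms, of "{p. P p}"]]
    by (simp add: xi_def)
qed

section \<open>Counting visible pairs\<close>

lemma inverse_power_antimono:
  fixes x :: real
  assumes "x \<ge> 1" "k \<le> m"
  shows "1 / x ^ m \<le> 1 / x ^ k"
  using assms by (intro divide_left_mono power_increasing) (auto intro: mult_pos_pos)

context lattice
begin

lemma cont_nat_0 [simp]: "cont_nat 0 = 0"
  using content_eq_0_iff[OF zero_mem] by simp

lemma content_dvd_add: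
  assumes "x \<in> \<Gamma>" "y \<in> \<Gamma>" "l dvd cont_nat x" "l dvd cont_nat y"
  shows "l dvd cont_nat (x + y)"
proof -
  have neg: "0 - y \<in> \<Gamma>" by (rule diff_mem[OF zero_mem assms(2)])
  have "l dvd cont_nat (0 - y)"
    by (rule content_dvd_diff[OF zero_mem assms(2) _ assms(4)]) simp
  then have "l dvd cont_nat (x - (0 - y))"
    by (rule content_dvd_diff[OF assms(1) neg assms(3)])
  then show ?thesis by simp
qed

text \<open>Chinese remaindering: with \<open>u * k + v * l = 1\<close>, the point \<open>t = u * k * a\<close> lies in \<open>k\<Gamma>\<close> while
  \<open>t - a = - v * l * a\<close> lies in \<open>l\<Gamma>\<close>.\<close>

lemma simultaneous_divisibility_coset:
  assumes a: "a \<in> \<Gamma>" and cop: "coprime k l"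
  obtains t where "t \<in> \<Gamma>"
    "\<And>x. x \<in> \<Gamma> \<Longrightarrow> k dvd cont_nat x \<and> l dvd cont_nat (x - a) \<longleftrightarrow> k * l dvd cont_nat (x - t)"
proof -
  obtain u v where uv: "u * int k + v * int l = 1"
    using bezout_int[of "int k" "int l"] cop by (auto simp: coprime_iff_gcd_eq_1)
  define t where "t = of_int (u * int k) *\<^sub>R a"
  have t: "t \<in> \<Gamma>" unfolding t_def by (rule scale_mem[OF a])
  have kt: "k dvd cont_nat t" unfolding t_def by (rule content_dvd_scale[OF a]) simp
  have "t - a = of_int (- v * int l) *\<^sub>R a"
  proof -
    have "- v * int l = u * int k - 1" using uv by simp
    then show ?thesis by (simp only: of_int_diff scaleR_diff_left t_def) simp
  qed
  then have lt: "l dvd cont_nat (t - a)" using content_dvd_scale[OF a, of l "- v * int l"] by simp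
  have "k dvd cont_nat x \<and> l dvd cont_nat (x - a) \<longleftrightarrow> k * l dvd cont_nat (x - t)" if x: "x \<in> \<Gamma>" for x
  proof
    assume *: "k dvd cont_nat x \<and> l dvd cont_nat (x - a)"
    have "k dvd cont_nat (x - t)" using * by (intro content_dvd_diff[OF x t _ kt]) auto
    moreover have "l dvd cont_nat ((x - a) - (t - a))"
      using * by (intro content_dvd_diff[OF diff_mem[OF x a] diff_mem[OF t a] _ lt]) auto
    ultimately show "k * l dvd cont_nat (x - t)" using cop by (simp add: divides_mult)
  next
    assume *: "k * l dvd cont_nat (x - t)"
    then have "k dvd cont_nat (x - t)" "l dvd cont_nat (x - t)"
      by (auto dest: dvd_mult_left dvd_mult_right)
    from content_dvd_add[OF diff_mem[OF x t] t this(1) kt]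
      content_dvd_add[OF diff_mem[OF x t] diff_mem[OF t a] this(2) lt]
    show "k dvd cont_nat x \<and> l dvd cont_nat (x - a)" by simp
  qed
  then show ?thesis using that t by blast
qed

lemma visible_iff_no_prime:
  assumes "x \<in> \<Gamma>"
  shows "x \<in> visible \<Gamma> \<longleftrightarrow> {p. prime p \<and> p dvd cont_nat x} = {}"
  using assms prime_factor_nat[of "cont_nat x"] by (auto simp: visible_iff)

definition pairs_upto :: "real^'n \<Rightarrow> nat \<Rightarrow> (nat set \<times> nat set) set" where
  "pairs_upto a M = {AB \<in> admissible {p. p dvd cont_nat a}. \<Prod>(fst AB) \<le> M \<and> \<Prod>(snd AB) \<le> M}"

lemma pairs_upto: "finite (pairs_upto a M)" "card (pairs_upto a M) \<le> M ^ 2"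
proof -
  let ?f = "\<lambda>AB. (\<Prod>(fst AB), \<Prod>(snd AB)) :: nat \<times> nat"
  have inj: "inj_on ?f (pairs_upto a M)"
  proof (rule inj_onI)
    fix x y assume "x \<in> pairs_upto a M" "y \<in> pairs_upto a M" "?f x = ?f y"
    moreover from this have "fst x \<in> prime_sets" "fst y \<in> prime_sets" "snd x \<in> prime_sets" "snd y \<in> prime_sets"
      by (auto simp: pairs_upto_def admissible_def)
    ultimately show "x = y"
      using inj_onD[OF inj_on_prod_prime_sets, of "fst x" "fst y"]
        inj_onD[OF inj_on_prod_prime_sets, of "snd x" "snd y"] by (intro prod_eqI) auto
  qed
  have sub: "?f ` pairs_upto a M \<subseteq> {1..M} \<times> {1..M}"
  proof
    fix y assume "y \<in> ?f ` pairs_upto a M"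
    then obtain A B where "y = (\<Prod>A, \<Prod>B)" "(A, B) \<in> pairs_upto a M" by auto
    then show "y \<in> {1..M} \<times> {1..M}"
      using prime_sets_prod_pos[of A] prime_sets_prod_pos[of B]
      by (simp add: pairs_upto_def admissible_def)
  qed
  show "finite (pairs_upto a M)" by (rule inj_on_finite[OF inj sub]) simp
  show "card (pairs_upto a M) \<le> M ^ 2"
    using card_inj_on_le[OF inj sub] by (simp add: power2_eq_square)
qed

text \<open>The pairs that contribute are exactly \<open>Pow Q1 \<times> Pow Q2\<close>, where \<open>Q1\<close> and \<open>Q2\<close> are the sets of
  primes obstructing the visibility of \<open>x\<close> and, in addition, of \<open>x - a\<close>. The cut-off \<open>M\<close>
  loses nothing, because a product of primes dividing a content is at most that content. The points
  \<open>0\<close> and \<open>a\<close> have to be excluded: every number divides the content \<open>0\<close>, so there the cut-off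
  would change the sum.\<close>

lemma visible_pair_indicator:
  assumes a: "a \<in> \<Gamma>" and x: "x \<in> \<Gamma>" "x \<noteq> 0" "x \<noteq> a"
    and M: "cont_nat x \<le> M" "cont_nat (x - a) \<le> M"
  shows "(\<Sum>AB\<in>pairs_upto a M.
      if \<Prod>(fst AB) dvd cont_nat x \<and> \<Prod>(snd AB) dvd cont_nat (x - a) then pair_sign AB else 0)
    = (if x \<in> visible \<Gamma> \<and> x - a \<in> visible \<Gamma> then 1 else 0)"
proof -
  define Q1 where "Q1 = {p. prime p \<and> p dvd cont_nat x}"
  define Q2 where "Q2 = {p. prime p \<and> p dvd cont_nat (x - a) \<and> \<not> p dvd cont_nat a}"
  have xa: "x - a \<in> \<Gamma>" by (rule diff_mem[OF x(1) a])
  have pos: "cont_nat x > 0" "cont_nat (x - a) > 0"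
    using content_eq_0_iff[OF x(1)] content_eq_0_iff[OF xa] x by auto
  have "Q1 \<subseteq> {..cont_nat x}" "Q2 \<subseteq> {..cont_nat (x - a)}"
    using pos by (auto simp: Q1_def Q2_def dest: dvd_imp_le)
  then have fin: "finite Q1" "finite Q2" by (auto intro: finite_subset)
  have disj: "Q1 \<inter> Q2 = {}"
  proof -
    have "p dvd cont_nat a" if "p dvd cont_nat x" "p dvd cont_nat (x - a)" for p
      using content_dvd_diff[OF x(1) xa that] by simp
    then show ?thesis by (auto simp: Q1_def Q2_def)
  qed
  have Qs: "A \<in> prime_sets" if "A \<subseteq> Q1 \<or> A \<subseteq> Q2" for A
    using that fin finite_subset[of A Q1] finite_subset[of A Q2]
    by (auto simp: prime_sets_def Q1_def Q2_def)
  have eq: "{AB \<in> pairs_upto a M. \<Prod>(fst AB) dvd cont_nat x \<and> \<Prod>(snd AB) dvd cont_nat (x - a)}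
      = Pow Q1 \<times> Pow Q2" (is "?L = ?R")
  proof (rule set_eqI, rule iffI)
    fix AB assume "AB \<in> ?L"
    then show "AB \<in> ?R"
      by (cases AB) (auto simp: pairs_upto_def admissible_def prod_prime_set_dvd_iff Q1_def Q2_def
          dest: prime_sets_D(2))
  next
    fix AB assume AB: "AB \<in> ?R"
    then have ps: "fst AB \<in> prime_sets" "snd AB \<in> prime_sets" using Qs by auto
    have dvd: "\<Prod>(fst AB) dvd cont_nat x" "\<Prod>(snd AB) dvd cont_nat (x - a)"
      using AB by (auto simp: prod_prime_set_dvd_iff ps Q1_def Q2_def)
    have "AB \<in> admissible {p. p dvd cont_nat a}"
      using AB ps disj by (cases AB) (auto simp: admissible_def Q2_def)
    moreover have "\<Prod>(fst AB) \<le> M" "\<Prod>(snd AB) \<le> M"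
      using dvd_imp_le[OF dvd(1) pos(1)] dvd_imp_le[OF dvd(2) pos(2)] M by auto
    ultimately show "AB \<in> ?L" using dvd by (auto simp: pairs_upto_def)
  qed
  have "(\<Sum>AB\<in>pairs_upto a M.
      if \<Prod>(fst AB) dvd cont_nat x \<and> \<Prod>(snd AB) dvd cont_nat (x - a) then pair_sign AB else 0)
    = (\<Sum>AB\<in>Pow Q1 \<times> Pow Q2. pair_sign AB)"
    unfolding eq[symmetric] by (rule sum.inter_filter[OF pairs_upto(1), symmetric])
  also have "\<dots> = (\<Sum>A\<in>Pow Q1. \<Sum>B\<in>Pow Q2. (-1) ^ card A * (-1) ^ card B)"
    by (simp add: sum.cartesian_product power_add case_prod_unfold)
  also have "\<dots> = (\<Sum>A\<in>Pow Q1. (-1) ^ card A) * (\<Sum>B\<in>Pow Q2. (-1) ^ card B)"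
    by (rule sum_product[symmetric])
  also have "\<dots> = (if Q1 = {} \<and> Q2 = {} then 1 else 0)"
    using sum_signs_Pow[OF fin(1)] sum_signs_Pow[OF fin(2)] by simp
  also have "Q1 = {} \<and> Q2 = {} \<longleftrightarrow> x \<in> visible \<Gamma> \<and> x - a \<in> visible \<Gamma>"
  proof -
    have "p dvd cont_nat x" if "p dvd cont_nat (x - a)" "p dvd cont_nat a" for p
      using content_dvd_add[OF xa a that] by simp
    then show ?thesis
      unfolding visible_iff_no_prime[OF x(1)] visible_iff_no_prime[OF xa]
      by (auto simp: Q1_def Q2_def)
  qed
  finally show ?thesis .
qed

definition visible_pairs :: "real^'n \<Rightarrow> real \<Rightarrow> (real^'n) set" where
  "visible_pairs a R = {x \<in> visible \<Gamma>. x - a \<in> visible \<Gamma> \<and> norm x < R \<and> norm (x - a) < R}"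

text \<open>Only pairs with both products up to \<open>M \<approx> R / \<delta>\<close> matter for points of norm below \<open>R\<close>. Summing
  the coset counts over them, the boundary terms give \<open>R ^ (n - 1)\<close> times a convergent series, since
  \<open>n - 1 \<ge> 2\<close>. The bounded errors, one for each of at most \<open>M\<^sup>2\<close> pairs, give \<open>O(R\<^sup>2)\<close>; this is absorbed by
  \<open>R ^ (n - 1)\<close> precisely because \<open>n \<ge> 3\<close>. Completing the truncated series of the main term costs
  another \<open>R ^ n * O(1 / R)\<close>.\<close>

theorem visible_pairs_asymptotics:
  assumes n3: "CARD('n) \<ge> 3" and a: "a \<in> \<Gamma>"
  obtains C where "\<And>R. R \<ge> 1 \<Longrightarrow>
    \<bar>real (card (visible_pairs a R)) - growth * pair_density CARD('n) {p. p dvd cont_nat a} * R ^ CARD('n)\<bar>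
      \<le> C * R ^ (CARD('n) - 1)"
proof -
  let ?n = "CARD('n)"
  let ?P = "{p. p dvd cont_nat a}"
  let ?S = "pair_density ?n ?P"
  let ?d = "\<lambda>AB. real (pair_prod AB)"
  obtain \<delta> where \<delta>: "\<delta> > 0" "\<And>x. x \<in> \<Gamma> \<Longrightarrow> x \<noteq> 0 \<Longrightarrow> \<delta> * real (cont_nat x) \<le> norm x"
    using content_le_norm by metis
  obtain K where K: "K \<ge> 0"
    "\<And>m R t. m \<ge> (1::nat) \<Longrightarrow> R \<ge> 0 \<Longrightarrow> t \<in> \<Gamma> \<Longrightarrow>
      \<bar>real (card {x \<in> \<Gamma>. norm x < R \<and> norm (x - a) < R \<and> m dvd cont_nat (x - t)})
        - growth * (R / m) ^ ?n\<bar> \<le> K * ((R / m) ^ (?n - 1) + 1)"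
    by (rule count_coset[of a]) blast
  define Z where "Z = (\<Sum>\<^sub>\<infinity>AB\<in>prime_sets \<times> prime_sets. 1 / ?d AB ^ 2)"
  have Zs: "(\<lambda>AB. 1 / ?d AB ^ 2) summable_on (prime_sets \<times> prime_sets)"
    by (rule summable_prime_set_pairs) simp
  have d1: "?d AB \<ge> 1" if "AB \<in> admissible ?P" for AB
    using pair_prod_pos[OF that] by linarith
  have main: "\<bar>real (card (visible_pairs a R)) - growth * ?S * R ^ ?n\<bar>
      \<le> ((K + 2) * (Z + 1 / \<delta>\<^sup>2) + growth * \<delta> * Z) * R ^ (?n - 1)" if R: "R \<ge> 1" for R
  proof -
    define M where "M = nat \<lfloor>R / \<delta>\<rfloor>"
    have M: "real M \<le> R / \<delta>" "R / \<delta> \<le> real M + 1" using R \<delta>(1) by (auto simp: M_def)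
    define I where "I = pairs_upto a M"
    have finI: "finite I" and cardI: "card I \<le> M ^ 2" and Iadm: "I \<subseteq> admissible ?P"
      using pairs_upto by (auto simp: I_def pairs_upto_def)
    \<comment> \<open>Neither \<open>0\<close> nor \<open>a\<close> belongs to a visible pair, so leaving them out does not change the count; the coset counts change by at most 2.\<close>
    define X where "X = {x \<in> \<Gamma>. x \<noteq> 0 \<and> x \<noteq> a \<and> norm x < R \<and> norm (x - a) < R}"
    have finX: "finite X" by (rule finite_subset[OF _ finite_norm_less[of R]]) (auto simp: X_def)
    let ?c = "\<lambda>x AB. \<Prod>(fst AB) dvd cont_nat x \<and> \<Prod>(snd AB) dvd cont_nat (x - a)"
    have bound: "cont_nat y \<le> M" if "y \<in> \<Gamma>" "y \<noteq> 0" "norm y < R" for y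
    proof -
      have "\<delta> * real (cont_nat y) \<le> R" using \<delta>(2)[OF that(1,2)] that(3) by linarith
      then have "real (cont_nat y) \<le> R / \<delta>" using \<delta>(1) by (simp add: field_simps)
      then show ?thesis unfolding M_def by (rule le_nat_floor)
    qed
    have "visible_pairs a R = {x \<in> X. x \<in> visible \<Gamma> \<and> x - a \<in> visible \<Gamma>}"
      using content_eq_0_iff[OF zero_mem]
      by (auto simp: visible_pairs_def X_def visible_iff)
    then have "real (card (visible_pairs a R)) = (\<Sum>x\<in>X. if x \<in> visible \<Gamma> \<and> x - a \<in> visible \<Gamma> then 1 else 0)"
      using finX by (simp add: sum.inter_filter[symmetric])
    also have "\<dots> = (\<Sum>x\<in>X. \<Sum>AB\<in>I. if ?c x AB then pair_sign AB else 0)"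
      unfolding I_def using bound diff_mem[OF _ a]
      by (intro sum.cong refl visible_pair_indicator[OF a, symmetric]) (auto simp: X_def)
    also have "\<dots> = (\<Sum>AB\<in>I. \<Sum>x\<in>X. if ?c x AB then pair_sign AB else 0)"
      by (rule sum.swap)
    also have "\<dots> = (\<Sum>AB\<in>I. pair_sign AB * real (card {x\<in>X. ?c x AB}))"
      using finX by (intro sum.cong refl) (simp add: sum.inter_filter[symmetric])
    finally have N: "real (card (visible_pairs a R)) = (\<Sum>AB\<in>I. pair_sign AB * real (card {x\<in>X. ?c x AB}))" .

    have each: "\<bar>real (card {x\<in>X. ?c x AB}) - growth * (R / ?d AB) ^ ?n\<bar>
        \<le> (K + 2) * (R ^ (?n - 1) * (1 / ?d AB ^ 2) + 1)" if AB: "AB \<in> I" for AB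
    proof -
      have adm: "fst AB \<in> prime_sets" "snd AB \<in> prime_sets" "fst AB \<inter> snd AB = {}"
        using subsetD[OF Iadm AB] by (auto simp: admissible_def case_prod_unfold)
      obtain t where t: "t \<in> \<Gamma>"
        "\<And>x. x \<in> \<Gamma> \<Longrightarrow> ?c x AB \<longleftrightarrow> pair_prod AB dvd cont_nat (x - t)"
        using simultaneous_divisibility_coset[OF a coprime_prod_prime_sets[OF adm]] by metis
      let ?Y = "{x \<in> \<Gamma>. norm x < R \<and> norm (x - a) < R \<and> pair_prod AB dvd cont_nat (x - t)}"
      have finY: "finite ?Y" by (rule finite_subset[OF _ finite_norm_less[of R]]) auto
      have sub: "{x\<in>X. ?c x AB} \<subseteq> ?Y" "?Y \<subseteq> {x\<in>X. ?c x AB} \<union> {0, a}"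
        using t(2) by (auto simp: X_def)
      have "card ?Y \<le> card ({x\<in>X. ?c x AB} \<union> {0, a})" using finX by (intro card_mono sub) auto
      also have "\<dots> \<le> card {x\<in>X. ?c x AB} + card {0, a}" by (rule card_Un_le)
      also have "\<dots> \<le> card {x\<in>X. ?c x AB} + 2" by (simp add: card_insert_if)
      finally have 1: "\<bar>real (card {x\<in>X. ?c x AB}) - real (card ?Y)\<bar> \<le> 2"
        using card_mono[OF finY sub(1)] by linarith
      have dd: "?d AB \<ge> 1" using d1 AB Iadm by blast
      then have 2: "\<bar>real (card ?Y) - growth * (R / ?d AB) ^ ?n\<bar> \<le> K * ((R / ?d AB) ^ (?n - 1) + 1)"
        using R by (intro K(2) t(1)) linarith+
      have "1 / ?d AB ^ (?n - 1) \<le> 1 / ?d AB ^ 2"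
        using n3 by (intro inverse_power_antimono dd) simp
      then have 3: "(R / ?d AB) ^ (?n - 1) \<le> R ^ (?n - 1) * (1 / ?d AB ^ 2)"
        using R mult_left_mono[of "1 / ?d AB ^ (?n - 1)" "1 / ?d AB ^ 2" "R ^ (?n - 1)"]
        by (simp add: power_divide)
      have "K * ((R / ?d AB) ^ (?n - 1) + 1) + 2 \<le> K * (R ^ (?n - 1) * (1 / ?d AB ^ 2) + 1) + 2 * (R ^ (?n - 1) * (1 / ?d AB ^ 2) + 1)"
        using 3 K(1) R by (intro add_mono mult_left_mono) auto
      then show ?thesis using 1 2 unfolding distrib_right by linarith
    qed

    have Zle: "(\<Sum>AB\<in>I. 1 / ?d AB ^ 2) \<le> Z"
      unfolding Z_def using finI Iadm admissible_subset by (intro finite_sum_le_infsum[OF Zs]) auto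
    have M2: "real (M ^ 2) \<le> 1 / \<delta>\<^sup>2 * R ^ (?n - 1)"
    proof -
      have "real M ^ 2 \<le> (R / \<delta>) ^ 2" using M(1) by (intro power_mono) auto
      also have "\<dots> = 1 / \<delta>\<^sup>2 * R ^ 2" by (simp add: power_divide)
      also have "\<dots> \<le> 1 / \<delta>\<^sup>2 * R ^ (?n - 1)"
        using R n3 by (intro mult_left_mono power_increasing) auto
      finally show ?thesis by simp
    qed
    have "\<bar>real (card (visible_pairs a R)) - (\<Sum>AB\<in>I. pair_sign AB * (growth * (R / ?d AB) ^ ?n))\<bar>
        = \<bar>\<Sum>AB\<in>I. pair_sign AB * (real (card {x\<in>X. ?c x AB}) - growth * (R / ?d AB) ^ ?n)\<bar>"
      unfolding N by (simp add: sum_subtractf right_diff_distrib)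
    also have "\<dots> \<le> (\<Sum>AB\<in>I. \<bar>real (card {x\<in>X. ?c x AB}) - growth * (R / ?d AB) ^ ?n\<bar>)"
      by (rule order.trans[OF sum_abs]) (simp add: abs_mult)
    also have "\<dots> \<le> (\<Sum>AB\<in>I. (K + 2) * (R ^ (?n - 1) * (1 / ?d AB ^ 2) + 1))"
      by (intro sum_mono each)
    also have "\<dots> = (K + 2) * (R ^ (?n - 1) * (\<Sum>AB\<in>I. 1 / ?d AB ^ 2) + real (card I))"
      by (simp only: sum_distrib_left[symmetric] sum.distrib) simp
    also have "\<dots> \<le> (K + 2) * (R ^ (?n - 1) * Z + 1 / \<delta>\<^sup>2 * R ^ (?n - 1))"
    proof (intro mult_left_mono add_mono Zle)
      show "real (card I) \<le> 1 / \<delta>\<^sup>2 * R ^ (?n - 1)" using cardI M2 by linarith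
    qed (use K(1) R in auto)
    also have "\<dots> = (K + 2) * (Z + 1 / \<delta>\<^sup>2) * R ^ (?n - 1)" by (simp add: algebra_simps)
    finally have E1: "\<bar>real (card (visible_pairs a R)) - (\<Sum>AB\<in>I. pair_sign AB * (growth * (R / ?d AB) ^ ?n))\<bar>
        \<le> (K + 2) * (Z + 1 / \<delta>\<^sup>2) * R ^ (?n - 1)" .

    let ?f = "\<lambda>AB. pair_sign AB / ?d AB ^ ?n"
    \<comment> \<open>The tail: outside of \<open>I\<close> the product of a pair is at least \<open>R / \<delta>\<close>, which gains a factor \<open>\<delta> / R\<close>.\<close>
    have hs: "(?f has_sum (?S - sum ?f I)) (admissible ?P - I)"
      using n3 by (intro has_sum_Diff pair_density_has_sum has_sum_finite finI Iadm) auto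
    have Zs': "(\<lambda>AB. \<delta> / R * (1 / ?d AB ^ 2)) summable_on (admissible ?P - I)"
      using admissible_subset by (intro summable_on_cmult_right summable_on_subset[OF Zs]) blast
    have "norm (?S - sum ?f I) \<le> (\<Sum>\<^sub>\<infinity>AB\<in>admissible ?P - I. \<delta> / R * (1 / ?d AB ^ 2))"
    proof (rule norm_infsum_le[OF hs has_sum_infsum[OF Zs']])
      fix AB assume AB: "AB \<in> admissible ?P - I"
      then have dd: "?d AB \<ge> 1" using d1 by blast
      have pp: "\<Prod>(fst AB) \<ge> 1" "\<Prod>(snd AB) \<ge> 1"
        using AB prime_sets_prod_pos by (force simp: admissible_def)+
      have "\<Prod>(fst AB) \<ge> M + 1 \<or> \<Prod>(snd AB) \<ge> M + 1"
        using AB by (auto simp: I_def pairs_upto_def)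
      then have "pair_prod AB \<ge> M + 1"
        using mult_le_mono[OF _ pp(2), of "M + 1" "\<Prod>(fst AB)"] mult_le_mono[OF pp(1), of "M + 1" "\<Prod>(snd AB)"]
        by auto
      then have "R / \<delta> \<le> ?d AB" using M(2) by linarith
      then have "1 / ?d AB \<le> \<delta> / R" using R \<delta>(1) dd by (simp add: field_simps)
      moreover have "1 / ?d AB ^ (?n - 1) \<le> 1 / ?d AB ^ 2"
        using n3 by (intro inverse_power_antimono dd) simp
      ultimately have "1 / ?d AB * (1 / ?d AB ^ (?n - 1)) \<le> \<delta> / R * (1 / ?d AB ^ 2)"
        using dd \<delta>(1) R by (intro mult_mono) auto
      moreover have "1 / ?d AB * (1 / ?d AB ^ (?n - 1)) = 1 / ?d AB ^ ?n"
        using n3 by (simp add: power_eq_if)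
      ultimately show "norm (?f AB) \<le> \<delta> / R * (1 / ?d AB ^ 2)"
        using dd by (simp add: abs_mult power_abs del: of_nat_mult of_nat_prod)
    qed
    also have "\<dots> = \<delta> / R * (\<Sum>\<^sub>\<infinity>AB\<in>admissible ?P - I. 1 / ?d AB ^ 2)"
      by (rule infsum_cmult_right')
    also have "\<dots> \<le> \<delta> / R * Z"
      unfolding Z_def using \<delta>(1) R admissible_subset
      by (intro mult_left_mono infsum_mono2 summable_on_subset[OF Zs] Zs) (auto intro: Zs)
    finally have "\<bar>?S - sum ?f I\<bar> \<le> \<delta> / R * Z" by simp
    then have "growth * R ^ ?n * \<bar>?S - sum ?f I\<bar> \<le> growth * R ^ ?n * (\<delta> / R * Z)"
      using growth_pos R by (intro mult_left_mono) auto
    also have "\<dots> = growth * \<delta> * Z * R ^ (?n - 1)"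
      using R n3 by (simp add: power_eq_if)
    also have "growth * R ^ ?n * \<bar>?S - sum ?f I\<bar> = \<bar>growth * R ^ ?n * (?S - sum ?f I)\<bar>"
      using growth_pos R by (simp add: abs_mult)
    also have "\<dots> = \<bar>growth * ?S * R ^ ?n - growth * R ^ ?n * sum ?f I\<bar>"
      by (simp only: right_diff_distrib mult_ac)
    also have "growth * R ^ ?n * sum ?f I = (\<Sum>AB\<in>I. pair_sign AB * (growth * (R / ?d AB) ^ ?n))"
      unfolding sum_distrib_left by (intro sum.cong refl) (simp add: power_divide)
    finally have E2: "\<bar>growth * ?S * R ^ ?n - (\<Sum>AB\<in>I. pair_sign AB * (growth * (R / ?d AB) ^ ?n))\<bar>
        \<le> growth * \<delta> * Z * R ^ (?n - 1)" .
    show ?thesis using E1 E2 unfolding distrib_right by linarith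
  qed
  show ?thesis by (rule that[OF main])
qed

end

section \<open>Test functions and combs of point masses\<close>

text \<open>Dominated convergence for unordered sums, along an arbitrary filter: outside a suitable finite set
  the dominating sum is small, and on the finite set the limit can be taken termwise.\<close>

lemma dominated_infsum_tendsto_0:
  fixes d :: "'i \<Rightarrow> 'a \<Rightarrow> real"
  assumes lim: "\<And>a. a \<in> A \<Longrightarrow> ((\<lambda>R. d R a) \<longlongrightarrow> 0) F"
    and bound: "\<forall>\<^sub>F R in F. \<forall>a\<in>A. 0 \<le> d R a \<and> d R a \<le> h a"
    and h: "h summable_on A"
  shows "((\<lambda>R. infsum (d R) A) \<longlongrightarrow> 0) F"
proof (rule tendstoI)
  fix e :: real assume e: "e > 0"
  obtain X where X: "finite X" "X \<subseteq> A" "dist (sum h X) (infsum h A) \<le> e / 2"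
    using infsum_finite_approximation[OF h, of "e / 2"] e by auto
  have "((\<lambda>R. \<Sum>a\<in>X. d R a) \<longlongrightarrow> (\<Sum>a\<in>X. 0)) F"
    using X by (intro tendsto_sum lim) auto
  then have "\<forall>\<^sub>F R in F. (\<Sum>a\<in>X. d R a) < e / 2"
    using e by (intro order_tendstoD(2)) auto
  with bound show "\<forall>\<^sub>F R in F. dist (infsum (d R) A) 0 < e"
  proof eventually_elim
    case (elim R)
    have dA: "d R summable_on A"
      by (rule summable_on_comparison_test[OF h]) (use elim in auto)
    have split: "infsum f A = sum f X + infsum f (A - X)" if "f summable_on A" for f :: "'a \<Rightarrow> real"
      using infsum_Diff[OF that summable_on_finite[OF X(1)] X(2)] X(1) by simp
    have "infsum (d R) (A - X) \<le> infsum h (A - X)"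
      using elim by (intro infsum_mono summable_on_subset[OF dA] summable_on_subset[OF h]) auto
    also have "\<dots> \<le> e / 2" using split[OF h] X(3) by (auto simp: dist_real_def)
    finally have "infsum (d R) A < e" using split[OF dA] elim by linarith
    moreover have "infsum (d R) A \<ge> 0" using elim by (intro infsum_nonneg) auto
    ultimately show ?case by simp
  qed
qed

lemma pderivs_add:
  assumes "smooth \<phi>" "smooth \<psi>"
  shows "pderivs \<alpha> (\<lambda>x. \<phi> x + \<psi> x) = (\<lambda>x. pderivs \<alpha> \<phi> x + pderivs \<alpha> \<psi> x)"
proof (induction \<alpha>)
  case (Cons i \<alpha>)
  show ?case
  proof
    fix x
    have "((\<lambda>x. pderivs \<alpha> \<phi> x + pderivs \<alpha> \<psi> x) has_derivative
        (\<lambda>v. frechet_derivative (pderivs \<alpha> \<phi>) (at x) v + frechet_derivative (pderivs \<alpha> \<psi>) (at x) v)) (at x)"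
      using assms by (intro has_derivative_add) (auto simp: smooth_def frechet_derivative_works[symmetric])
    from frechet_derivative_at[OF this]
    show "pderivs (i # \<alpha>) (\<lambda>x. \<phi> x + \<psi> x) x = pderivs (i # \<alpha>) \<phi> x + pderivs (i # \<alpha>) \<psi> x"
      by (simp add: Cons.IH fun_eq_iff)
  qed
qed simp

lemma pderivs_scale:
  assumes "smooth \<phi>"
  shows "pderivs \<alpha> (\<lambda>x. c * \<phi> x) = (\<lambda>x. c * pderivs \<alpha> \<phi> x)"
proof (induction \<alpha>)
  case (Cons i \<alpha>)
  show ?case
  proof
    fix x
    have "((\<lambda>x. c * pderivs \<alpha> \<phi> x) has_derivative
        (\<lambda>v. c * frechet_derivative (pderivs \<alpha> \<phi>) (at x) v)) (at x)"
      using assms by (intro has_derivative_mult_right) (auto simp: smooth_def frechet_derivative_works[symmetric])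
    from frechet_derivative_at[OF this]
    show "pderivs (i # \<alpha>) (\<lambda>x. c * \<phi> x) x = c * pderivs (i # \<alpha>) \<phi> x"
      by (simp add: Cons.IH fun_eq_iff)
  qed
qed simp

lemma schwartz_bound:
  assumes "\<phi> \<in> schwartz"
  obtains M where "\<And>x. (1 + norm x) ^ k * norm (pderivs \<alpha> \<phi> x) \<le> M"
proof -
  have "bdd_above (range (\<lambda>x. (1 + norm x) ^ k * norm (pderivs \<alpha> \<phi> x)))"
    using assms by (auto simp: schwartz_def)
  then obtain M where "\<And>x. (1 + norm x) ^ k * norm (pderivs \<alpha> \<phi> x) \<le> M"
    by (auto simp: bdd_above_def)
  then show ?thesis using that by blast
qed

lemma schwartz_add:
  assumes "\<phi> \<in> schwartz" "\<psi> \<in> schwartz"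
  shows "(\<lambda>x. \<phi> x + \<psi> x) \<in> schwartz"
proof -
  have sm: "smooth \<phi>" "smooth \<psi>" using assms by (auto simp: schwartz_def)
  have "smooth (\<lambda>x. \<phi> x + \<psi> x)"
    using sm unfolding smooth_def[of "\<lambda>x. \<phi> x + \<psi> x"] pderivs_add[OF sm]
    by (intro allI differentiable_add) (auto simp: smooth_def)
  moreover have "bdd_above (range (\<lambda>x. (1 + norm x) ^ k * norm (pderivs \<alpha> (\<lambda>x. \<phi> x + \<psi> x) x)))" for k \<alpha>
  proof -
    obtain M where M: "\<And>x. (1 + norm x) ^ k * norm (pderivs \<alpha> \<phi> x) \<le> M"
      using schwartz_bound[OF assms(1)] by metis
    obtain N where N: "\<And>x. (1 + norm x) ^ k * norm (pderivs \<alpha> \<psi> x) \<le> N"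
      using schwartz_bound[OF assms(2)] by metis
    have "(1 + norm x) ^ k * norm (pderivs \<alpha> \<phi> x + pderivs \<alpha> \<psi> x) \<le> M + N" for x
    proof -
      have "(1 + norm x) ^ k * norm (pderivs \<alpha> \<phi> x + pderivs \<alpha> \<psi> x)
          \<le> (1 + norm x) ^ k * (norm (pderivs \<alpha> \<phi> x) + norm (pderivs \<alpha> \<psi> x))"
        by (intro mult_left_mono norm_triangle_ineq) simp
      also have "\<dots> \<le> M + N" using M[of x] N[of x] by (simp add: distrib_left)
      finally show ?thesis .
    qed
    then show ?thesis unfolding pderivs_add[OF sm] by (intro bdd_aboveI2)
  qed
  ultimately show ?thesis by (auto simp: schwartz_def)
qed

lemma schwartz_scale:
  assumes "\<phi> \<in> schwartz"
  shows "(\<lambda>x. c * \<phi> x) \<in> schwartz"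
proof -
  have sm: "smooth \<phi>" using assms by (auto simp: schwartz_def)
  have "smooth (\<lambda>x. c * \<phi> x)"
    using sm unfolding smooth_def[of "\<lambda>x. c * \<phi> x"] pderivs_scale[OF sm]
    by (intro allI differentiable_mult differentiable_const) (auto simp: smooth_def)
  moreover have "bdd_above (range (\<lambda>x. (1 + norm x) ^ k * norm (pderivs \<alpha> (\<lambda>x. c * \<phi> x) x)))" for k \<alpha>
  proof -
    obtain M where M: "\<And>x. (1 + norm x) ^ k * norm (pderivs \<alpha> \<phi> x) \<le> M"
      using schwartz_bound[OF assms] by metis
    have "(1 + norm x) ^ k * norm (c * pderivs \<alpha> \<phi> x) \<le> norm c * M" for x
      using mult_left_mono[OF M[of x] norm_ge_zero[of c]] by (simp add: norm_mult algebra_simps)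
    then show ?thesis unfolding pderivs_scale[OF sm] by (intro bdd_aboveI2)
  qed
  ultimately show ?thesis by (auto simp: schwartz_def)
qed

lemma schwartz_diff_le_seminorm:
  assumes "\<phi> \<in> schwartz" "\<psi> \<in> schwartz"
  shows "norm (\<psi> x - \<phi> x) \<le> schwartz_seminorm k [] (\<lambda>x. \<psi> x - \<phi> x) / (1 + norm x) ^ k"
proof -
  have "(\<lambda>x. \<psi> x + (-1) * \<phi> x) \<in> schwartz"
    by (intro schwartz_add schwartz_scale assms)
  then have d: "(\<lambda>x. \<psi> x - \<phi> x) \<in> schwartz" by simp
  have "bdd_above (range (\<lambda>x. (1 + norm x) ^ k * norm (pderivs [] (\<lambda>x. \<psi> x - \<phi> x) x)))"
    using d unfolding schwartz_def mem_Collect_eq by (elim conjE allE)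
  then have "(1 + norm x) ^ k * norm (pderivs [] (\<lambda>x. \<psi> x - \<phi> x) x) \<le> schwartz_seminorm k [] (\<lambda>x. \<psi> x - \<phi> x)"
    unfolding schwartz_seminorm_def by (rule cSUP_upper[OF UNIV_I])
  moreover have "(1 + norm x) ^ k > 0" by (intro zero_less_power) (simp add: add_pos_nonneg)
  ultimately show ?thesis by (simp add: pos_le_divide_eq mult.commute)
qed

lemma openin_schwartz_seminorm_ball:
  assumes "\<phi> \<in> schwartz" "r > 0"
  shows "openin schwartz_topology {\<psi> \<in> schwartz. schwartz_seminorm k \<alpha> (\<lambda>x. \<psi> x - \<phi> x) < r}"
  unfolding schwartz_topology_def using assms by (intro topology_generated_by_Basis) blast

lemma center_in_schwartz_seminorm_ball:
  assumes "\<phi> \<in> schwartz" "r > 0"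
  shows "\<phi> \<in> {\<psi> \<in> schwartz. schwartz_seminorm k [] (\<lambda>x. \<psi> x - \<phi> x) < r}"
  using assms by (simp add: schwartz_seminorm_def)

lemma topspace_schwartz: "topspace schwartz_topology = schwartz"
proof
  show "topspace schwartz_topology \<subseteq> schwartz"
    unfolding schwartz_topology_def topology_generated_by_topspace by blast
  show "schwartz \<subseteq> topspace schwartz_topology"
    using openin_subset[OF openin_schwartz_seminorm_ball[where r = 1 and k = 0 and \<alpha> = "[]"]]
      center_in_schwartz_seminorm_ball[where r = 1 and k = 0] by fastforce
qed

text \<open>A single seminorm without derivatives suffices below, because sums of point masses only see the
  decay of a test function.\<close>

lemma continuous_map_schwartzI:
  fixes T :: "(real^'n::finite \<Rightarrow> complex) \<Rightarrow> complex"
  assumes "\<And>\<phi> \<psi>. \<phi> \<in> schwartz \<Longrightarrow> \<psi> \<in> schwartz \<Longrightarrow>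
    norm (T \<psi> - T \<phi>) \<le> C * schwartz_seminorm k [] (\<lambda>x. \<psi> x - \<phi> x)"
  shows "continuous_map schwartz_topology euclidean T"
  unfolding continuous_map_def topspace_schwartz
proof (intro conjI allI impI)
  fix U :: "complex set" assume "openin euclidean U"
  then have U: "open U" by simp
  show "openin schwartz_topology {\<phi> \<in> schwartz. T \<phi> \<in> U}"
  proof (subst openin_subopen, intro ballI)
    fix \<phi> assume "\<phi> \<in> {\<phi> \<in> schwartz. T \<phi> \<in> U}"
    then have \<phi>: "\<phi> \<in> schwartz" "T \<phi> \<in> U" by auto
    then obtain e where e: "e > 0" "ball (T \<phi>) e \<subseteq> U" using U open_contains_ball by blast
    define r where "r = e / (\<bar>C\<bar> + 1)"
    have r: "r > 0" using e by (simp add: r_def)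
    let ?B = "{\<psi> \<in> schwartz. schwartz_seminorm k [] (\<lambda>x. \<psi> x - \<phi> x) < r}"
    have "T \<psi> \<in> U" if "\<psi> \<in> ?B" for \<psi>
    proof -
      let ?s = "schwartz_seminorm k [] (\<lambda>x. \<psi> x - \<phi> x)"
      have \<psi>: "\<psi> \<in> schwartz" "?s < r" using that by auto
      have "0 \<le> ?s"
        using order.trans[OF norm_ge_zero schwartz_diff_le_seminorm[OF \<phi>(1) \<psi>(1), of 0 k]] by simp
      then have "C * ?s \<le> (\<bar>C\<bar> + 1) * ?s" by (intro mult_right_mono) auto
      also have "\<dots> < (\<bar>C\<bar> + 1) * r" using \<psi>(2) by (intro mult_strict_left_mono) auto
      also have "\<dots> = e" by (simp add: r_def)
      finally have "norm (T \<psi> - T \<phi>) < e" using assms[OF \<phi>(1) \<psi>(1)] by linarith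
      then show ?thesis using e(2) by (auto simp: dist_norm norm_minus_commute)
    qed
    then show "\<exists>B. openin schwartz_topology B \<and> \<phi> \<in> B \<and> B \<subseteq> {\<phi> \<in> schwartz. T \<phi> \<in> U}"
      using openin_schwartz_seminorm_ball[OF \<phi>(1) r] center_in_schwartz_seminorm_ball[OF \<phi>(1) r]
      by (intro exI[of _ ?B]) auto
  qed
qed simp

context lattice
begin

lemma card_norm_less_le:
  obtains C where "C \<ge> 0" "\<And>R. R \<ge> 1 \<Longrightarrow> real (card {x \<in> \<Gamma>. norm x < R}) \<le> C * R ^ CARD('n)"
proof (rule that[of "growth * (1 + cell_radius) ^ CARD('n)"])
  have rad: "cell_radius \<ge> 0" by (simp add: cell_radius_def sum_nonneg)
  then show "growth * (1 + cell_radius) ^ CARD('n) \<ge> 0" using growth_pos by simp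
  fix R :: real assume R: "R \<ge> 1"
  have "{x \<in> \<Gamma>. norm x < R} = \<Gamma> \<inter> ball 0 R" by auto
  then have "real (card {x \<in> \<Gamma>. norm x < R}) \<le> growth * (R + cell_radius) ^ CARD('n)"
    using count_upper(2)[OF subset_refl, of R 0] R by simp
  also have "\<dots> \<le> growth * ((1 + cell_radius) * R) ^ CARD('n)"
    using growth_pos rad R mult_left_mono[of 1 R cell_radius]
    by (intro mult_left_mono power_mono) (auto simp: distrib_right)
  finally show "real (card {x \<in> \<Gamma>. norm x < R}) \<le> growth * (1 + cell_radius) ^ CARD('n) * R ^ CARD('n)"
    by (simp add: power_mult_distrib)
qed

text \<open>Group the points by the integer part \<open>i\<close> of their norm: a shell contains \<open>O((i + 1) ^ n)\<close> points,
  each of weight at most \<open>1 / (i + 1) ^ (n + 2)\<close>.\<close>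

lemma summable_lattice_decay: "(\<lambda>x. 1 / (1 + norm x) ^ (CARD('n) + 2)) summable_on \<Gamma>"
proof (rule nonneg_bdd_above_summable_on)
  let ?n = "CARD('n)"
  let ?g = "\<lambda>x::real^'n. 1 / (1 + norm x) ^ (?n + 2)"
  obtain C where C: "C \<ge> 0" "\<And>R. R \<ge> 1 \<Longrightarrow> real (card {x \<in> \<Gamma>. norm x < R}) \<le> C * R ^ ?n"
    using card_norm_less_le by metis
  have sm: "summable (\<lambda>j. C * (1 / real (Suc j) ^ 2))"
  proof (intro summable_mult)
    have "summable (\<lambda>j. 1 / real j ^ 2)"
      using inverse_power_summable[of 2, where 'a=real] by (simp add: inverse_eq_divide power_one_over)
    then show "summable (\<lambda>j. 1 / real (Suc j) ^ 2)"
      by (subst summable_Suc_iff)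
  qed
  show "bdd_above (sum ?g ` {F. F \<subseteq> \<Gamma> \<and> finite F})"
  proof (rule bdd_aboveI2)
    fix F assume "F \<in> {F. F \<subseteq> \<Gamma> \<and> finite F}"
    then have F: "F \<subseteq> \<Gamma>" "finite F" by auto
    define j where "j x = nat \<lfloor>norm x\<rfloor>" for x :: "real^'n"
    have "(\<Sum>x\<in>F. ?g x) = (\<Sum>i\<in>j ` F. \<Sum>x\<in>{x\<in>F. j x = i}. ?g x)"
      using F by (intro sum.group[symmetric]) auto
    also have "\<dots> \<le> (\<Sum>i\<in>j ` F. C * (1 / real (Suc i) ^ 2))"
    proof (rule sum_mono)
      fix i
      have jx: "real i \<le> norm x \<and> norm x < real (Suc i)" if "j x = i" for x
        using that[symmetric] unfolding j_def by (simp add: of_nat_nat) linarith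
      have "(\<Sum>x\<in>{x\<in>F. j x = i}. ?g x) \<le> (\<Sum>x\<in>{x\<in>F. j x = i}. 1 / real (Suc i) ^ (?n + 2))"
        using jx by (intro sum_mono divide_left_mono power_mono) (auto intro!: mult_pos_pos zero_less_power simp: add_pos_nonneg)
      also have "\<dots> = real (card {x\<in>F. j x = i}) * (1 / real (Suc i) ^ (?n + 2))" by simp
      also have "\<dots> \<le> real (card {x \<in> \<Gamma>. norm x < real (Suc i)}) * (1 / real (Suc i) ^ (?n + 2))"
        using F jx by (intro mult_right_mono of_nat_mono card_mono finite_norm_less) auto
      also have "\<dots> \<le> (C * real (Suc i) ^ ?n) * (1 / real (Suc i) ^ (?n + 2))"
        by (intro mult_right_mono C) auto
      also have "\<dots> = C * (1 / real (Suc i) ^ 2)"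
        by (simp add: power_add power2_eq_square del: of_nat_Suc)
      finally show "(\<Sum>x\<in>{x\<in>F. j x = i}. ?g x) \<le> C * (1 / real (Suc i) ^ 2)" .
    qed
    also have "\<dots> \<le> (\<Sum>i. C * (1 / real (Suc i) ^ 2))"
      using F C(1) by (intro sum_le_suminf sm) auto
    finally show "sum ?g F \<le> (\<Sum>i. C * (1 / real (Suc i) ^ 2))" .
  qed
qed simp

definition decay_sum :: real where
  "decay_sum = (\<Sum>\<^sub>\<infinity>x\<in>\<Gamma>. 1 / (1 + norm x) ^ (CARD('n) + 2))"

lemma lattice_sum_bound:
  fixes f :: "real^'n \<Rightarrow> complex"
  assumes "\<And>x. x \<in> \<Gamma> \<Longrightarrow> norm (f x) \<le> B / (1 + norm x) ^ (CARD('n) + 2)"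
  shows "f summable_on \<Gamma>" and "norm (infsum f \<Gamma>) \<le> B * decay_sum"
proof -
  have s: "(\<lambda>x::real^'n. B * (1 / (1 + norm x) ^ (CARD('n) + 2))) summable_on \<Gamma>"
    by (rule summable_on_cmult_right[OF summable_lattice_decay])
  then have "(\<lambda>x. norm (f x)) summable_on \<Gamma>"
    by (rule summable_on_comparison_test) (use assms in auto)
  then show f: "f summable_on \<Gamma>" by (rule abs_summable_summable)
  have "norm (infsum f \<Gamma>) \<le> (\<Sum>\<^sub>\<infinity>x\<in>\<Gamma>. B * (1 / (1 + norm x) ^ (CARD('n) + 2)))"
    by (rule norm_infsum_le[OF has_sum_infsum[OF f] has_sum_infsum[OF s]]) (use assms in auto)
  also have "\<dots> = B * decay_sum" unfolding decay_sum_def by (rule infsum_cmult_right')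
  finally show "norm (infsum f \<Gamma>) \<le> B * decay_sum" .
qed

definition dirac_comb :: "(real^'n \<Rightarrow> real) \<Rightarrow> (real^'n \<Rightarrow> complex) \<Rightarrow> complex" where
  "dirac_comb c = (\<lambda>\<phi>\<in>schwartz. \<Sum>\<^sub>\<infinity>a\<in>\<Gamma>. of_real (c a) * \<phi> a)"

lemma weighted_bound:
  assumes "\<And>a. a \<in> \<Gamma> \<Longrightarrow> \<bar>c a\<bar> \<le> W" "a \<in> \<Gamma>" "(1 + norm a) ^ k * norm z \<le> M"
  shows "norm (of_real (c a) * z :: complex) \<le> (W * M) / (1 + norm a) ^ k"
proof -
  have pos: "(1 + norm a) ^ k > 0" by (intro zero_less_power) (simp add: add_pos_nonneg)
  have "0 \<le> W" using assms(1)[OF assms(2)] by linarith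
  then have "\<bar>c a\<bar> * ((1 + norm a) ^ k * norm z) \<le> W * M"
    using assms pos by (intro mult_mono) auto
  then show ?thesis using pos by (simp add: norm_mult pos_le_divide_eq algebra_simps)
qed

lemma dirac_comb_has_sum:
  assumes W: "\<And>a. a \<in> \<Gamma> \<Longrightarrow> \<bar>c a\<bar> \<le> W" and \<phi>: "\<phi> \<in> schwartz"
  shows "((\<lambda>a. of_real (c a) * \<phi> a) has_sum dirac_comb c \<phi>) \<Gamma>"
proof -
  obtain M where M: "\<And>x. (1 + norm x) ^ (CARD('n) + 2) * norm (pderivs [] \<phi> x) \<le> M"
    using schwartz_bound[OF \<phi>] by metis
  have "(\<lambda>a. of_real (c a) * \<phi> a) summable_on \<Gamma>"
    by (rule lattice_sum_bound(1)[of _ "W * M"], rule weighted_bound[OF W]) (use M in auto)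
  then show ?thesis using \<phi> by (simp add: dirac_comb_def)
qed

text \<open>Both the limit and the finite approximations of the autocorrelation are of this form, so one
  argument shows that all of them are tempered.\<close>

lemma dirac_comb_tempered:
  assumes W: "\<And>a. a \<in> \<Gamma> \<Longrightarrow> \<bar>c a\<bar> \<le> W"
  shows "dirac_comb c \<in> tempered_distributions"
proof -
  have add: "dirac_comb c (\<lambda>x. \<phi> x + \<psi> x) = dirac_comb c \<phi> + dirac_comb c \<psi>"
    if "\<phi> \<in> schwartz" "\<psi> \<in> schwartz" for \<phi> \<psi>
  proof (rule has_sum_unique[OF dirac_comb_has_sum[OF W schwartz_add[OF that]]])
    show "((\<lambda>a. of_real (c a) * (\<phi> a + \<psi> a)) has_sum dirac_comb c \<phi> + dirac_comb c \<psi>) \<Gamma>"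
      using has_sum_add[OF dirac_comb_has_sum[OF W that(1)] dirac_comb_has_sum[OF W that(2)]]
      by (simp add: distrib_left)
  qed
  have scale: "dirac_comb c (\<lambda>x. z * \<phi> x) = z * dirac_comb c \<phi>"
    if "\<phi> \<in> schwartz" for z \<phi>
  proof (rule has_sum_unique[OF dirac_comb_has_sum[OF W schwartz_scale[OF that]]])
    show "((\<lambda>a. of_real (c a) * (z * \<phi> a)) has_sum z * dirac_comb c \<phi>) \<Gamma>"
      using has_sum_cmult_right[OF dirac_comb_has_sum[OF W that], where c = z]
      by (simp add: algebra_simps)
  qed
  have "norm (dirac_comb c \<psi> - dirac_comb c \<phi>)
      \<le> W * decay_sum * schwartz_seminorm (CARD('n) + 2) [] (\<lambda>x. \<psi> x - \<phi> x)"
    if \<phi>: "\<phi> \<in> schwartz" and \<psi>: "\<psi> \<in> schwartz" for \<phi> \<psi>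
  proof -
    let ?s = "schwartz_seminorm (CARD('n) + 2) [] (\<lambda>x. \<psi> x - \<phi> x)"
    have "((\<lambda>a. of_real (c a) * \<psi> a + (-1) * (of_real (c a) * \<phi> a)) has_sum
        dirac_comb c \<psi> + (-1) * dirac_comb c \<phi>) \<Gamma>"
      by (intro has_sum_add has_sum_cmult_right dirac_comb_has_sum[OF W] \<phi> \<psi>)
    then have "((\<lambda>a. of_real (c a) * (\<psi> a - \<phi> a)) has_sum dirac_comb c \<psi> - dirac_comb c \<phi>) \<Gamma>"
      by (simp add: algebra_simps)
    then have "dirac_comb c \<psi> - dirac_comb c \<phi> = (\<Sum>\<^sub>\<infinity>a\<in>\<Gamma>. of_real (c a) * (\<psi> a - \<phi> a))"
      by (rule infsumI[symmetric])
    also have "norm \<dots> \<le> (W * ?s) * decay_sum"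
    proof (rule lattice_sum_bound(2), rule weighted_bound[OF W])
      fix x :: "real^'n"
      have "(1 + norm x) ^ (CARD('n) + 2) > 0" by (intro zero_less_power) (simp add: add_pos_nonneg)
      then show "(1 + norm x) ^ (CARD('n) + 2) * norm (\<psi> x - \<phi> x) \<le> ?s"
        using schwartz_diff_le_seminorm[OF \<phi> \<psi>, of x "CARD('n) + 2"]
        by (simp add: pos_le_divide_eq mult.commute)
    qed
    finally show ?thesis by (simp add: algebra_simps)
  qed
  then have "continuous_map schwartz_topology euclidean (dirac_comb c)"
    by (rule continuous_map_schwartzI)
  then show ?thesis
    using add scale by (simp add: tempered_distributions_def dirac_comb_def)
qed

lemma dirac_comb_tendsto:
  assumes bound: "\<forall>\<^sub>F R in F. \<forall>a\<in>\<Gamma>. \<bar>c R a\<bar> \<le> W"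
    and lim: "\<And>a. a \<in> \<Gamma> \<Longrightarrow> ((\<lambda>R. c R a) \<longlongrightarrow> w a) F"
    and w: "\<And>a. a \<in> \<Gamma> \<Longrightarrow> \<bar>w a\<bar> \<le> W"
    and \<phi>: "\<phi> \<in> schwartz"
  shows "((\<lambda>R. dirac_comb (c R) \<phi>) \<longlongrightarrow> dirac_comb w \<phi>) F"
proof -
  obtain M where M: "\<And>x. (1 + norm x) ^ (CARD('n) + 2) * norm (pderivs [] \<phi> x) \<le> M"
    using schwartz_bound[OF \<phi>] by metis
  let ?h = "\<lambda>a::real^'n. (2 * W * M) * (1 / (1 + norm a) ^ (CARD('n) + 2))"
  let ?d = "\<lambda>R a. norm (of_real (c R a - w a) * \<phi> a)"
  have h: "?h summable_on \<Gamma>" by (rule summable_on_cmult_right[OF summable_lattice_decay])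
  have dle: "?d R a \<le> ?h a" if "\<forall>a\<in>\<Gamma>. \<bar>c R a\<bar> \<le> W" "a \<in> \<Gamma>" for R a
  proof -
    have "\<bar>c R a - w a\<bar> \<le> 2 * W" if "a \<in> \<Gamma>" for a
      using \<open>\<forall>a\<in>\<Gamma>. \<bar>c R a\<bar> \<le> W\<close> w[OF that] that abs_triangle_ineq4[of "c R a" "w a"] by force
    from weighted_bound[OF this \<open>a \<in> \<Gamma>\<close>, where k = "CARD('n) + 2" and z = "\<phi> a" and M = M] show ?thesis
      using M[of a] by simp
  qed
  have "((\<lambda>R. infsum (?d R) \<Gamma>) \<longlongrightarrow> 0) F"
  proof (rule dominated_infsum_tendsto_0[OF _ _ h])
    show "((\<lambda>R. ?d R a) \<longlongrightarrow> 0) F" if "a \<in> \<Gamma>" for a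
    proof -
      have "((\<lambda>R. norm (of_real (c R a - w a) * \<phi> a)) \<longlongrightarrow> norm (of_real (w a - w a) * \<phi> a)) F"
        by (intro tendsto_intros lim that)
      then show ?thesis by simp
    qed
    show "\<forall>\<^sub>F R in F. \<forall>a\<in>\<Gamma>. 0 \<le> ?d R a \<and> ?d R a \<le> ?h a"
      using bound by eventually_elim (use dle in auto)
  qed
  moreover have "\<forall>\<^sub>F R in F. norm (dirac_comb (c R) \<phi> - dirac_comb w \<phi>) \<le> infsum (?d R) \<Gamma>"
    using bound
  proof eventually_elim
    case (elim R)
    then have cR: "\<And>a. a \<in> \<Gamma> \<Longrightarrow> \<bar>c R a\<bar> \<le> W" by blast
    have "((\<lambda>a. of_real (c R a) * \<phi> a + (-1) * (of_real (w a) * \<phi> a)) has_sum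
        dirac_comb (c R) \<phi> + (-1) * dirac_comb w \<phi>) \<Gamma>"
      by (intro has_sum_add has_sum_cmult_right dirac_comb_has_sum[OF cR] dirac_comb_has_sum[OF w] \<phi>)
    then have 1: "((\<lambda>a. of_real (c R a - w a) * \<phi> a) has_sum dirac_comb (c R) \<phi> - dirac_comb w \<phi>) \<Gamma>"
      by (simp add: algebra_simps)
    have "?d R summable_on \<Gamma>"
      by (rule summable_on_comparison_test[OF h]) (use dle elim in auto)
    from norm_infsum_le[OF 1 has_sum_infsum[OF this]] show ?case by simp
  qed
  ultimately have "((\<lambda>R. dirac_comb (c R) \<phi> - dirac_comb w \<phi>) \<longlongrightarrow> 0) F"
    by (rule Lim_null_comparison[rotated])
  then show ?thesis by (rule LIM_zero_cancel)
qed


section \<open>The autocorrelation of the visible points\<close>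

lemma visible_subset: "visible \<Gamma> \<subseteq> \<Gamma>"
  by (auto simp: visible_def)

definition pair_frequency :: "real \<Rightarrow> real^'n \<Rightarrow> real" where
  "pair_frequency R a = ball_normalizer TYPE('n) R * real (card (visible_pairs a R))"

text \<open>Group the pairs \<open>(x, y)\<close> by their difference \<open>a = x - y\<close>; a pair is determined by \<open>x\<close> and \<open>a\<close>.\<close>

lemma finite_autocorrelation_eq_dirac_comb:
  "finite_autocorrelation (visible \<Gamma>) R = dirac_comb (pair_frequency R)"
proof
  fix \<phi> :: "real^'n \<Rightarrow> complex"
  show "finite_autocorrelation (visible \<Gamma>) R \<phi> = dirac_comb (pair_frequency R) \<phi>"
  proof (cases "\<phi> \<in> schwartz")
    case True
    let ?B = "{x \<in> visible \<Gamma>. norm x < R}"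
    let ?d = "\<lambda>(x, y). x - y :: real^'n"
    have finB: "finite ?B"
      by (rule finite_subset[OF _ finite_norm_less[of R]]) (use visible_subset in auto)
    define D where "D = ?d ` (?B \<times> ?B)"
    have finD: "finite D" unfolding D_def using finB by (intro finite_imageI finite_cartesian_product)
    have sub: "D \<subseteq> \<Gamma>" unfolding D_def using diff_mem visible_subset by fastforce
    have fibre: "card {p \<in> ?B \<times> ?B. ?d p = a} = card (visible_pairs a R)" for a
    proof (rule bij_betw_same_card)
      show "bij_betw fst {p \<in> ?B \<times> ?B. ?d p = a} (visible_pairs a R)"
        by (rule bij_betw_byWitness[where f' = "\<lambda>x. (x, x - a)"]) (auto simp: visible_pairs_def)
    qed
    have "(\<Sum>(x, y) \<in> ?B \<times> ?B. dirac (x - y) \<phi>) = (\<Sum>p \<in> ?B \<times> ?B. \<phi> (?d p))"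
      using True by (intro sum.cong) (auto simp: dirac_def)
    also have "\<dots> = (\<Sum>a\<in>D. \<Sum>p \<in> {p \<in> ?B \<times> ?B. ?d p = a}. \<phi> (?d p))"
      using finB finD by (intro sum.group[symmetric]) (auto simp: D_def)
    also have "\<dots> = (\<Sum>a\<in>D. of_nat (card (visible_pairs a R)) * \<phi> a)"
      unfolding fibre[symmetric] by (intro sum.cong refl) simp
    finally have eq: "(\<Sum>(x, y) \<in> ?B \<times> ?B. dirac (x - y) \<phi>) =
        (\<Sum>a\<in>D. of_nat (card (visible_pairs a R)) * \<phi> a)" .
    have "finite_autocorrelation (visible \<Gamma>) R \<phi> =
        of_real (ball_normalizer TYPE('n) R) * (\<Sum>(x, y) \<in> ?B \<times> ?B. dirac (x - y) \<phi>)"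
      unfolding finite_autocorrelation_def using True by (rule restrict_apply')
    also have "\<dots> = (\<Sum>a\<in>D. of_real (pair_frequency R a) * \<phi> a)"
      unfolding eq by (simp add: pair_frequency_def sum_distrib_left mult.assoc)
    also have "\<dots> = (\<Sum>\<^sub>\<infinity>a\<in>D. of_real (pair_frequency R a) * \<phi> a)"
      by (rule infsum_finite[OF finD, symmetric])
    also have "\<dots> = (\<Sum>\<^sub>\<infinity>a\<in>\<Gamma>. of_real (pair_frequency R a) * \<phi> a)"
    proof (rule infsum_cong_neutral)
      fix a assume "a \<in> \<Gamma> - D"
      have "visible_pairs a R = {}"
      proof (rule ccontr)
        assume "visible_pairs a R \<noteq> {}"
        then obtain x where "x \<in> visible_pairs a R" by blast
        then have "(x, x - a) \<in> ?B \<times> ?B" by (auto simp: visible_pairs_def)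
        then have "?d (x, x - a) \<in> D" unfolding D_def by (rule imageI)
        then show False using \<open>a \<in> \<Gamma> - D\<close> by simp
      qed
      then show "of_real (pair_frequency R a) * \<phi> a = 0" by (simp add: pair_frequency_def)
    qed (use sub in auto)
    finally show ?thesis using True by (simp add: dirac_comb_def)
  qed (simp add: finite_autocorrelation_def dirac_comb_def)
qed

text \<open>The bound is uniform in \<open>a\<close>; together with the decay of test functions it is the dominating function
  for the passage to the limit.\<close>

lemma pair_frequency_bound:
  obtains W where "\<And>R a. R \<ge> 1 \<Longrightarrow> \<bar>pair_frequency R a\<bar> \<le> W"
proof -
  let ?v = "measure lborel (ball (0::real^'n) 1)"
  have v: "?v > 0" by (simp add: content_ball)
  obtain C where C: "C \<ge> 0" "\<And>R. R \<ge> 1 \<Longrightarrow> real (card {x \<in> \<Gamma>. norm x < R}) \<le> C * R ^ CARD('n)"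
    using card_norm_less_le by metis
  have "\<bar>pair_frequency R a\<bar> \<le> C / ?v" if R: "R \<ge> 1" for R a
  proof -
    have "real (card (visible_pairs a R)) \<le> real (card {x \<in> \<Gamma>. norm x < R})"
      using visible_subset by (intro of_nat_mono card_mono finite_norm_less) (auto simp: visible_pairs_def)
    also have "\<dots> \<le> C * R ^ CARD('n)" by (rule C(2)[OF R])
    finally have "1 / (?v * R ^ CARD('n)) * real (card (visible_pairs a R))
        \<le> 1 / (?v * R ^ CARD('n)) * (C * R ^ CARD('n))"
      using v R by (intro mult_left_mono) auto
    also have "\<dots> = C / ?v" using v R by simp
    finally show ?thesis using v R by (simp add: pair_frequency_def ball_normalizer_def)
  qed
  then show ?thesis using that by blast
qed

definition autocorrelation_weight :: "real^'n \<Rightarrow> real" where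
  "autocorrelation_weight a = dens \<Gamma> * pair_density CARD('n) {p. p dvd cont_nat a}"

lemma autocorrelation_weight_error:
  assumes "CARD('n) \<ge> 3" "a \<in> \<Gamma>"
  obtains C where "\<And>R. R \<ge> 1 \<Longrightarrow> \<bar>autocorrelation_weight a - pair_frequency R a\<bar> \<le> C * (1 / R)"
proof -
  let ?v = "measure lborel (ball (0::real^'n) 1)"
  have v: "?v > 0" by (simp add: content_ball)
  let ?N = "\<lambda>R. real (card (visible_pairs a R))"
  obtain C where C: "\<And>R. R \<ge> 1 \<Longrightarrow>
    \<bar>?N R - growth * pair_density CARD('n) {p. p dvd cont_nat a} * R ^ CARD('n)\<bar>
      \<le> C * R ^ (CARD('n) - 1)"
    using visible_pairs_asymptotics[OF assms] by metis
  have "\<bar>autocorrelation_weight a - pair_frequency R a\<bar> \<le> C / ?v * (1 / R)" if R: "R \<ge> 1" for R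
  proof -
    let ?M = "growth * pair_density CARD('n) {p. p dvd cont_nat a} * R ^ CARD('n)"
    have pos: "?v * R ^ CARD('n) > 0" using v R by simp
    have "autocorrelation_weight a = ?M / (?v * R ^ CARD('n))"
      using v R by (simp add: autocorrelation_weight_def growth_def)
    then have "autocorrelation_weight a - pair_frequency R a = (?M - ?N R) / (?v * R ^ CARD('n))"
      unfolding diff_divide_distrib pair_frequency_def ball_normalizer_def by simp
    then have "\<bar>autocorrelation_weight a - pair_frequency R a\<bar> = \<bar>?N R - ?M\<bar> / (?v * R ^ CARD('n))"
      using pos by (simp only: abs_divide abs_of_pos abs_minus_commute[of ?M])
    also have "\<dots> \<le> (C * R ^ (CARD('n) - 1)) / (?v * R ^ CARD('n))"
      using pos by (intro divide_right_mono C[OF R]) simp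
    also have "\<dots> = C / ?v * (1 / R)"
      unfolding power_minus_mult[of "CARD('n)" R, OF zero_less_card_finite, symmetric]
      using R v by simp
    finally show ?thesis .
  qed
  then show ?thesis using that by blast
qed

lemma pair_frequency_tendsto:
  assumes "CARD('n) \<ge> 3" "a \<in> \<Gamma>"
  shows "((\<lambda>R. pair_frequency R a) \<longlongrightarrow> autocorrelation_weight a) at_top"
proof -
  obtain C where C: "\<And>R. R \<ge> 1 \<Longrightarrow> \<bar>autocorrelation_weight a - pair_frequency R a\<bar> \<le> C * (1 / R)"
    using autocorrelation_weight_error[OF assms] by metis
  have "((\<lambda>R. C * (1 / R)) \<longlongrightarrow> C * 0) at_top"
    by (intro tendsto_mult tendsto_const tendsto_divide_0[OF tendsto_const] filterlim_at_top_imp_at_infinity filterlim_ident)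
  then have lim0: "((\<lambda>R. C * (1 / R)) \<longlongrightarrow> 0) at_top" by simp
  have "((\<lambda>R. pair_frequency R a - autocorrelation_weight a) \<longlongrightarrow> 0) at_top"
  proof (rule Lim_null_comparison[OF _ lim0])
    show "\<forall>\<^sub>F R in at_top. norm (pair_frequency R a - autocorrelation_weight a) \<le> C * (1 / R)"
      using eventually_ge_at_top[of 1]
      by eventually_elim (use C in \<open>simp add: abs_minus_commute\<close>)
  qed
  then show ?thesis by (rule LIM_zero_cancel)
qed

text \<open>The coefficients of the finite approximations are uniformly bounded and converge for every
  difference, so dominated convergence gives convergence on every test function, which is weak*
  convergence.\<close>

theorem visible_points_autocorrelation:
  assumes n3: "CARD('n) \<ge> 3"
  shows "has_natural_autocorrelation (visible \<Gamma>) (dirac_comb autocorrelation_weight)"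
    and "is_dirac_comb (dirac_comb autocorrelation_weight) \<Gamma> autocorrelation_weight"
proof -
  obtain W where W: "\<And>R a. R \<ge> 1 \<Longrightarrow> \<bar>pair_frequency R a\<bar> \<le> W"
    using pair_frequency_bound by metis
  have w: "\<bar>autocorrelation_weight a\<bar> \<le> W" if "a \<in> \<Gamma>" for a
  proof (rule tendsto_upperbound[OF tendsto_rabs[OF pair_frequency_tendsto[OF n3 that]]])
    show "\<forall>\<^sub>F R in at_top. \<bar>pair_frequency R a\<bar> \<le> W"
      using eventually_ge_at_top[of 1] by eventually_elim (rule W)
  qed simp
  have tempered: "dirac_comb autocorrelation_weight \<in> tempered_distributions"
    using w by (rule dirac_comb_tempered)
  have "dirac a \<phi> = \<phi> a" if "\<phi> \<in> schwartz" for a :: "real^'n" and \<phi>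
    using that by (simp add: dirac_def)
  then show "is_dirac_comb (dirac_comb autocorrelation_weight) \<Gamma> autocorrelation_weight"
    unfolding is_dirac_comb_def using tempered dirac_comb_has_sum[OF w] by simp
  have ev: "\<forall>\<^sub>F R in at_top. finite_autocorrelation (visible \<Gamma>) R \<in> tempered_distributions"
    using eventually_ge_at_top[of 1]
    by eventually_elim (auto simp: finite_autocorrelation_eq_dirac_comb intro!: dirac_comb_tempered W)
  have evW: "\<forall>\<^sub>F R in at_top. \<forall>a\<in>\<Gamma>. \<bar>pair_frequency R a\<bar> \<le> W"
    using eventually_ge_at_top[of 1] by eventually_elim (use W in blast)
  have "((\<lambda>R. finite_autocorrelation (visible \<Gamma>) R \<phi>) \<longlongrightarrow> dirac_comb autocorrelation_weight \<phi>) at_top"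
    if "\<phi> \<in> schwartz" for \<phi>
    unfolding finite_autocorrelation_eq_dirac_comb
    by (rule dirac_comb_tendsto[OF evW pair_frequency_tendsto[OF n3] w that])
  moreover have "T \<in> extensional schwartz" if "T \<in> tempered_distributions" for T :: "(real^'n \<Rightarrow> complex) \<Rightarrow> complex"
    using that by (simp add: tempered_distributions_def)
  ultimately have "limitin weak_star (finite_autocorrelation (visible \<Gamma>)) (dirac_comb autocorrelation_weight) at_top"
    unfolding weak_star_def limitin_subtopology limitin_componentwise
    using tempered ev by (auto simp: PiE_def elim: eventually_mono)
  moreover have "uniform_discrete (visible \<Gamma>)"
    by (rule uniform_discrete_subset[OF uniform_discrete visible_subset])
  ultimately show "has_natural_autocorrelation (visible \<Gamma>) (dirac_comb autocorrelation_weight)"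
    by (simp add: has_natural_autocorrelation_def)
qed

lemma autocorrelation_weight_formula:
  assumes "CARD('n) \<ge> 3" "a \<in> \<Gamma>"
  shows "autocorrelation_weight a = dens \<Gamma> * xi (real CARD('n)) *
    (\<Prod>p. if prime p \<and> enat p dvd cont \<Gamma> a then 1 + 1 / (real p ^ CARD('n) - 2) else 1)"
proof -
  have "prime p \<and> enat p dvd cont \<Gamma> a \<longleftrightarrow> prime p \<and> p dvd cont_nat a" for p
    using prime_dvd_cont_iff[OF assms(2)] by blast
  then show ?thesis
    unfolding autocorrelation_weight_def
    using pair_density_eq_prodinf[of "CARD('n)" "\<lambda>p. p dvd cont_nat a"] assms(1) by simp
qed

end

theorem theorem1:
  fixes \<Gamma> :: "(real^'n::finite) set"
  assumes "CARD('n) \<ge> 3"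
    and "is_lattice \<Gamma>"
  shows "\<exists>\<gamma> w. has_natural_autocorrelation (visible \<Gamma>) \<gamma> \<and>
           is_dirac_comb \<gamma> \<Gamma> w \<and>
           (\<forall>a\<in>\<Gamma>.
              w a = dens \<Gamma> * xi (real CARD('n)) *
                (\<Prod>p. if prime p \<and> enat p dvd cont \<Gamma> a
                      then 1 + 1 / (real p ^ CARD('n) - 2) else 1) \<and>
              (\<lambda>R. \<bar>w a - ball_normalizer TYPE('n) R *
                     real (card {x \<in> visible \<Gamma>. x - a \<in> visible \<Gamma> \<and> norm x < R \<and> norm (x - a) < R})\<bar>)
                \<in> O[at_top](\<lambda>R. 1 / R))"
proof -
  obtain b where "lattice_basis b \<Gamma>" using assms(2) by (auto simp: is_lattice_def)
  then interpret lattice \<Gamma> b by unfold_locales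
  have "(\<lambda>R. \<bar>autocorrelation_weight a - ball_normalizer TYPE('n) R *
        real (card {x \<in> visible \<Gamma>. x - a \<in> visible \<Gamma> \<and> norm x < R \<and> norm (x - a) < R})\<bar>)
      \<in> O[at_top](\<lambda>R. 1 / R)" if "a \<in> \<Gamma>" for a
  proof -
    obtain C where C: "\<And>R. R \<ge> 1 \<Longrightarrow> \<bar>autocorrelation_weight a - pair_frequency R a\<bar> \<le> C * (1 / R)"
      using autocorrelation_weight_error[OF assms(1) \<open>a \<in> \<Gamma>\<close>] by metis
    have "(\<lambda>R. \<bar>autocorrelation_weight a - pair_frequency R a\<bar>) \<in> O[at_top](\<lambda>R. 1 / R)"
    proof (rule bigoI[of _ C])
      show "\<forall>\<^sub>F R in at_top. norm \<bar>autocorrelation_weight a - pair_frequency R a\<bar> \<le> C * norm (1 / R)"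
        using eventually_ge_at_top[of 1] by eventually_elim (use C in simp)
    qed
    then show ?thesis unfolding pair_frequency_def visible_pairs_def .
  qed
  then show ?thesis
    using visible_points_autocorrelation[OF assms(1)] autocorrelation_weight_formula[OF assms(1)]
    by blast
qed

end
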